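(* Let $u\in H^k(\Omega)$. The error incurred by truncating the infinite Tensor Train expansion $$u=\sum_{i_1=1}^{\infty}\sum_{i_2=1}^{\infty}\cdots\sum_{i_{d-1}=1}^{\infty}\lambda_{i_1}\lambda_{i_1i_2}\cdots\lambda_{i_1\cdots i_{d-1}}\,\psi^{(1)}_{i_1}\psi^{(2)}_{i_1i_2}\cdots\psi^{(d-1)}_{i_1\cdots i_{d-1}}\psi^{(d)}_{i_1\cdots i_{d-1}}$$ (obtained by recursive bi-orthogonal decomposition) to the finite expansion $$\tilde u=\sum_{i_1=1}^{r_1}\sum_{i_2=1}^{r_2}\cdots\sum_{i_{d-1}=1}^{r_{d-1}}\lambda_{i_1}\lambda_{i_1i_2}\cdots\lambda_{i_1\cdots i_{d-1}}\,\psi^{(1)}_{i_1}\psi^{(2)}_{i_1i_2}\cdots\psi^{(d-1)}_{i_1\cdots i_{d-1}}\psi^{(d)}_{i_1\cdots i_{d-1}}$$ is given by $$\|u-\tilde u\|^2_{H^k(\Omega)}=\sum_{i_1=r_1+1}^{\infty}\lambda_{i_1}^2+\sum_{i_1=1}^{r_1}\sum_{i_2=r_2+1}^{\infty}\lambda_{i_1}^2\lambda_{i_1i_2}^2+\cdots+\sum_{i_1=1}^{r_1}\sum_{i_2=1}^{r_2}\cdots\sum_{i_{d-2}=1}^{r_{d-2}}\;\sum_{i_{d-1}=r_{d-1}+1}^{\infty}\lambda_{i_1}^2\lambda_{i_1i_2}^2\cdots\lambda_{i_1\cdots i_{d-1}}^2 .$$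
   Context: Let $d\ge 2$, let $k\ge 0$ be an integer, and let $\Omega=\Omega^{(1)}\times\cdots\times\Omega^{(d)}\subseteq\mathbb{R}^d$ be a Cartesian product of one-dimensional domains that contains an open set, with variables $x_j\in\Omega^{(j)}$. Write $\Omega^{(p,\dots,q)}=\Omega^{(p)}\times\cdots\times\Omega^{(q)}$. All functions are real valued. Superscripts on a function indicate the variables it depends on; e.g. $\psi^{(j,\dots,d)}$ is a function of $(x_j,\dots,x_d)$. Sobolev spaces: $H^k(\Omega)=\{u\in L^2(\Omega): D^{\alpha}u\in L^2(\Omega)\text{ for all }|\alpha|\le k\}$, where $\alpha=(\alpha_1,\dots,\alpha_d)$ is a multi-index, $|\alpha|=\alpha_1+\cdots+\alpha_d$ and $D^\alpha u=\partial^{|\alpha|}u/\partial x_1^{\alpha_1}\cdots\partial x_d^{\alpha_d}$. It is equipped with the standard inner product $$\langle f,g\rangle_{H^k(\Omega)}=\sum_{|\alpha|\le k}\int_\Omega D^\alpha f\,D^\alpha g\,dx_1\cdots dx_d$$ and the associated norm. Likewise, each space $H^k(\Omega^{(p,\dots,q)})$ is equipped with the inner product $$\langle f,g\rangle_{H^k(\Omega^{(p,\dots,q)})}=\sum_{\alpha_p+\cdots+\alpha_q\le k}\int_{\Omega^{(p,\dots,q)}}\frac{\partial^{\alpha_p+\cdots+\alpha_q}f}{\partial x_p^{\alpha_p}\cdots\partial x_q^{\alpha_q}}\,\frac{\partial^{\alpha_p+\cdots+\alpha_q}g}{\partial x_p^{\alpha_p}\cdots\partial x_q^{\alpha_q}}\,dx_p\cdots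 dx_q .$$ One uses the isomorphisms $H^k(\Omega)\cong H^k(\Omega^{(1)})\otimes H^k(\Omega^{(2,\dots,d)})$ and, recursively, $H^k(\Omega^{(j,\dots,d)})\cong H^k(\Omega^{(j)})\otimes H^k(\Omega^{(j+1,\dots,d)})$. Bi-orthogonal decomposition: for $v\in H^k(\Omega^{(j,\dots,d)})$ with $1\le j\le d-1$, define the operator $U_v:H^k(\Omega^{(j)})\to H^k(\Omega^{(j+1,\dots,d)})$ by $U_v\psi=\langle v,\psi\rangle_{H^k(\Omega^{(j)})}$ and its formal adjoint $U_v^\dagger:H^k(\Omega^{(j+1,\dots,d)})\to H^k(\Omega^{(j)})$ by $U_v^\dagger\varphi=\langle v,\varphi\rangle_{H^k(\Omega^{(j+1,\dots,d)})}$ (the inner products being taken in the indicated variables). The bi-orthogonal decomposition of $v$ is the series, converging in norm, $$v=\sum_{i=1}^\infty\lambda_i\,\psi_i^{(j)}\psi_i^{(j+1,\dots,d)},$$ where $\lambda_1\ge\lambda_2\ge\cdots\ge0$, $U_v\psi_i^{(j)}=\lambda_i\psi_i^{(j+1,\dots,d)}$, $U_v^\dagger\psi_i^{(j+1,\dots,d)}=\lambda_i\psi_i^{(j)}$, the modes $\psi_i^{(j)}$ are orthonormal in $H^k(\Omega^{(j)})$ and the modes $\psi_i^{(j+1,\dots,d)}$ are orthonormal in $H^k(\Omega^{(j+1,\dots,d)})$, with respect to the inner products above. Recursive (Tensor Train) decomposition: first $u=\sum_{i_1=1}^\infty\lambda_{i_1}\psi^{(1)}_{i_1}\psi^{(2,\dots,d)}_{i_1}$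 is the bi-orthogonal decomposition of $u$; then, for $j=2,\dots,d-1$ and every $(i_1,\dots,i_{j-1})$, $$\psi^{(j,\dots,d)}_{i_1\cdots i_{j-1}}=\sum_{i_j=1}^{\infty}\lambda_{i_1\cdots i_j}\,\psi^{(j)}_{i_1\cdots i_j}\,\psi^{(j+1,\dots,d)}_{i_1\cdots i_j}$$ is the bi-orthogonal decomposition of $\psi^{(j,\dots,d)}_{i_1\cdots i_{j-1}}$. Substituting these decompositions into one another gives the infinite expansion of $u$ in the claim. The truncation ranks $r_1,\dots,r_{d-1}$ are finite; in all sums $r_j$ abbreviates $r_j(i_1,\dots,i_{j-1})$ for $j\ge2$, i.e. the truncation rank at level $j$ may depend on the preceding indices.
   Formalization: In several variables, H^k and its inner product and norm use all multi-indices with every α_j ≤ k (so the tensor-product isomorphism is isometric) instead of |α| ≤ k, for which the identity fails when k ≥ 1; for k = 0 and for one-variable factors nothing changes. *)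

theory Defs
  imports "HOL-Analysis.Analysis"
begin

text \<open>
  Coordinates are numbered by natural numbers. A point \<open>(x\<^sub>p, ..., x\<^sub>q)\<close> of a block of variables
  is an extensional function on \<open>{p..q}\<close>, i.e. an element of \<open>PiE {p..q} \<Omega>\<close>;
  the block carries Lebesgue measure (product of \<open>lborel\<close>). In particular a function of
  the single variable \<open>x\<^sub>j\<close> is a function on \<open>PiE {j} \<Omega>\<close>. Elements of \<open>L\<^sup>2\<close> are given by
  Borel representatives and compared almost everywhere.
\<close>

type_synonym point = "nat \<Rightarrow> real"
type_synonym multi_index = "nat \<Rightarrow> nat"

definition block_measure :: "(nat \<Rightarrow> real set) \<Rightarrow> nat set \<Rightarrow> point measure" where
  "block_measure \<Omega> J = PiM J (\<lambda>j. restrict_space lborel (\<Omega> j))"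

definition one_dim_domain :: "real set \<Rightarrow> bool" where
  "one_dim_domain S \<longleftrightarrow> connected S \<and> interior S \<noteq> {}"

subsection \<open>Test functions and weak derivatives\<close>

definition partial_deriv :: "nat \<Rightarrow> (point \<Rightarrow> real) \<Rightarrow> point \<Rightarrow> real" where
  "partial_deriv j f x = deriv (\<lambda>t. f (x(j := t))) (x j)"

primrec C_order :: "nat \<Rightarrow> nat set \<Rightarrow> (point \<Rightarrow> real) \<Rightarrow> bool" where
  "C_order 0 J f \<longleftrightarrow> continuous_on (PiE J (\<lambda>_. UNIV)) f"
| "C_order (Suc n) J f \<longleftrightarrow> continuous_on (PiE J (\<lambda>_. UNIV)) f \<and>
     (\<forall>j\<in>J. (\<forall>x\<in>PiE J (\<lambda>_. UNIV). (\<lambda>t. f (x(j := t))) field_differentiable at (x j)) \<and>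
            C_order n J (partial_deriv j f))"

definition test_function :: "(nat \<Rightarrow> real set) \<Rightarrow> nat set \<Rightarrow> (point \<Rightarrow> real) \<Rightarrow> bool" where
  "test_function \<Omega> J f \<longleftrightarrow> (\<forall>n. C_order n J f) \<and>
     (\<exists>K. compact K \<and> K \<subseteq> PiE J (\<lambda>j. interior (\<Omega> j)) \<and>
          (\<forall>x \<in> PiE J (\<lambda>_. UNIV) - K. f x = 0))"

definition classical_deriv :: "nat set \<Rightarrow> multi_index \<Rightarrow> (point \<Rightarrow> real) \<Rightarrow> point \<Rightarrow> real" where
  "classical_deriv J \<alpha> f = fold (\<lambda>j. partial_deriv j ^^ \<alpha> j) (sorted_list_of_set J) f"

definition square_integrable :: "(nat \<Rightarrow> real set) \<Rightarrow> nat set \<Rightarrow> (point \<Rightarrow> real) \<Rightarrow> bool" where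
  "square_integrable \<Omega> J f \<longleftrightarrow> f \<in> borel_measurable (block_measure \<Omega> J) \<and>
     integrable (block_measure \<Omega> J) (\<lambda>x. (f x)\<^sup>2)"

definition is_weak_deriv ::
  "(nat \<Rightarrow> real set) \<Rightarrow> nat set \<Rightarrow> multi_index \<Rightarrow> (point \<Rightarrow> real) \<Rightarrow> (point \<Rightarrow> real) \<Rightarrow> bool" where
  "is_weak_deriv \<Omega> J \<alpha> f g \<longleftrightarrow> (\<forall>\<phi>. test_function \<Omega> J \<phi> \<longrightarrow>
     (\<integral>x. f x * classical_deriv J \<alpha> \<phi> x \<partial>block_measure \<Omega> J) =
     (-1) ^ (\<Sum>j\<in>J. \<alpha> j) * (\<integral>x. g x * \<phi> x \<partial>block_measure \<Omega> J))"

text \<open>A representative of the (a.e. unique) weak derivative \<open>D\<^sup>\<alpha> f \<in> L\<^sup>2\<close>, when there is one.\<close>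

definition weak_deriv ::
  "(nat \<Rightarrow> real set) \<Rightarrow> nat set \<Rightarrow> multi_index \<Rightarrow> (point \<Rightarrow> real) \<Rightarrow> point \<Rightarrow> real" where
  "weak_deriv \<Omega> J \<alpha> f = (SOME g. square_integrable \<Omega> J g \<and> is_weak_deriv \<Omega> J \<alpha> f g)"

subsection \<open>Sobolev spaces and their inner products\<close>

definition sobolev_space ::
  "multi_index set \<Rightarrow> (nat \<Rightarrow> real set) \<Rightarrow> nat set \<Rightarrow> (point \<Rightarrow> real) set" where
  "sobolev_space A \<Omega> J = {f. square_integrable \<Omega> J f \<and>
     (\<forall>\<alpha>\<in>A. \<exists>g. square_integrable \<Omega> J g \<and> is_weak_deriv \<Omega> J \<alpha> f g)}"

definition sobolev_inner ::
  "multi_index set \<Rightarrow> (nat \<Rightarrow> real set) \<Rightarrow> nat set \<Rightarrow> (point \<Rightarrow> real) \<Rightarrow> (point \<Rightarrow> real) \<Rightarrow> real" where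
  "sobolev_inner A \<Omega> J f g =
     (\<Sum>\<alpha>\<in>A. \<integral>x. weak_deriv \<Omega> J \<alpha> f x * weak_deriv \<Omega> J \<alpha> g x \<partial>block_measure \<Omega> J)"

definition total_indices :: "nat \<Rightarrow> nat set \<Rightarrow> multi_index set" where
  "total_indices k J = {\<alpha>. (\<forall>j. j \<notin> J \<longrightarrow> \<alpha> j = 0) \<and> (\<Sum>j\<in>J. \<alpha> j) \<le> k}"

definition tensor_indices :: "nat \<Rightarrow> nat set \<Rightarrow> multi_index set" where
  "tensor_indices k J = {\<alpha>. (\<forall>j. j \<notin> J \<longrightarrow> \<alpha> j = 0) \<and> (\<forall>j\<in>J. \<alpha> j \<le> k)}"

text \<open>
  The decomposition uses the identification of \<open>H\<^sup>k\<close> of the block \<open>{j..d}\<close> with the Hilbert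
  space tensor product of \<open>H\<^sup>k\<close> of \<open>{j}\<close> and \<open>H\<^sup>k\<close> of \<open>{j+1..d}\<close>, hence, recursively, with the
  tensor product of the one-dimensional spaces \<open>H\<^sup>k\<close>, each of which carries the standard inner
  product. The inner product transported along it is the sum over the multi-indices with
  every \<open>\<alpha>\<^sub>j \<le> k\<close> (\<open>tensor_indices\<close>); the space consists of the functions all of whose
  derivatives of this kind are in \<open>L\<^sup>2\<close>. For one variable, and for \<open>k = 0\<close> in any number
  of variables, this is the usual space and inner product over \<open>|\<alpha>| \<le> k\<close> (\<open>total_indices\<close>;
  see the two lemmas below).

  For \<open>k \<ge> 1\<close> and at least two variables the sum over \<open>|\<alpha>| \<le> k\<close> does not make the
  identification isometric, and it cannot be used here: with respect to it the error formula
  fails already for two variables and \<open>k = 1\<close>. Moreover \<open>\<langle>v, \<psi>\<rangle>\<close> taken in \<open>x\<^sub>j\<close> is in \<open>H\<^sup>k\<close> of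
  the remaining variables for all \<open>\<psi>\<close> only if \<open>v\<close> has mixed derivatives of order above \<open>k\<close>.
\<close>

definition Hk :: "nat \<Rightarrow> (nat \<Rightarrow> real set) \<Rightarrow> nat set \<Rightarrow> (point \<Rightarrow> real) set" where
  "Hk k \<Omega> J = sobolev_space (tensor_indices k J) \<Omega> J"

definition Hk_inner ::
  "nat \<Rightarrow> (nat \<Rightarrow> real set) \<Rightarrow> nat set \<Rightarrow> (point \<Rightarrow> real) \<Rightarrow> (point \<Rightarrow> real) \<Rightarrow> real" where
  "Hk_inner k \<Omega> J = sobolev_inner (tensor_indices k J) \<Omega> J"

definition Hk_norm :: "nat \<Rightarrow> (nat \<Rightarrow> real set) \<Rightarrow> nat set \<Rightarrow> (point \<Rightarrow> real) \<Rightarrow> real" where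
  "Hk_norm k \<Omega> J f = sqrt (Hk_inner k \<Omega> J f f)"

lemma tensor_indices_zero: "finite J \<Longrightarrow> tensor_indices 0 J = total_indices 0 J"
  unfolding tensor_indices_def total_indices_def by auto

lemma tensor_indices_single: "tensor_indices k {j} = total_indices k {j}"
  unfolding tensor_indices_def total_indices_def by auto

lemma Hk_standard:
  assumes "finite J" and "k = 0 \<or> card J = 1"
  shows "Hk k \<Omega> J = sobolev_space (total_indices k J) \<Omega> J"
    and "Hk_inner k \<Omega> J = sobolev_inner (total_indices k J) \<Omega> J"
  using assms
  by (auto simp: Hk_def Hk_inner_def card_1_singleton_iff tensor_indices_zero tensor_indices_single)

subsection \<open>Bi-orthogonal decomposition\<close>

definition tensor_fun ::
  "nat set \<Rightarrow> nat set \<Rightarrow> (point \<Rightarrow> real) \<Rightarrow> (point \<Rightarrow> real) \<Rightarrow> point \<Rightarrow> real" where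
  "tensor_fun I J f g = (\<lambda>x. f (restrict x I) * g (restrict x J))"

text \<open>
  The inner product of \<open>v\<close> (a function on the block \<open>I \<union> J\<close>) and \<open>f\<close> (a function on the
  block \<open>I\<close>) in the variables of \<open>I\<close> only; the result is a function on the block \<open>J\<close>.
  With \<open>I = {j}\<close>, \<open>J = {j+1..d}\<close> this is \<open>U\<^sub>v\<close>, with the roles exchanged its formal adjoint.
\<close>

definition Hk_partial_inner ::
  "nat \<Rightarrow> (nat \<Rightarrow> real set) \<Rightarrow> nat set \<Rightarrow> nat set \<Rightarrow>
   (point \<Rightarrow> real) \<Rightarrow> (point \<Rightarrow> real) \<Rightarrow> point \<Rightarrow> real" where
  "Hk_partial_inner k \<Omega> I J v f = (\<lambda>y. \<Sum>\<alpha>\<in>tensor_indices k I.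
     \<integral>x. weak_deriv \<Omega> (I \<union> J) \<alpha> v (merge I J (x, y)) * weak_deriv \<Omega> I \<alpha> f x
       \<partial>block_measure \<Omega> I)"

definition U_op ::
  "nat \<Rightarrow> (nat \<Rightarrow> real set) \<Rightarrow> nat \<Rightarrow> nat \<Rightarrow>
   (point \<Rightarrow> real) \<Rightarrow> (point \<Rightarrow> real) \<Rightarrow> point \<Rightarrow> real" where
  "U_op k \<Omega> d j v \<psi> = Hk_partial_inner k \<Omega> {j} {j+1..d} v \<psi>"

definition U_adj ::
  "nat \<Rightarrow> (nat \<Rightarrow> real set) \<Rightarrow> nat \<Rightarrow> nat \<Rightarrow>
   (point \<Rightarrow> real) \<Rightarrow> (point \<Rightarrow> real) \<Rightarrow> point \<Rightarrow> real" where
  "U_adj k \<Omega> d j v \<phi> = Hk_partial_inner k \<Omega> {j+1..d} {j} v \<phi>"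

definition orthonormal_modes ::
  "nat \<Rightarrow> (nat \<Rightarrow> real set) \<Rightarrow> nat set \<Rightarrow> (nat \<Rightarrow> point \<Rightarrow> real) \<Rightarrow> bool" where
  "orthonormal_modes k \<Omega> J \<psi> \<longleftrightarrow> (\<forall>i\<ge>1. \<psi> i \<in> Hk k \<Omega> J) \<and>
     (\<forall>i\<ge>1. \<forall>l\<ge>1. Hk_inner k \<Omega> J (\<psi> i) (\<psi> l) = (if i = l then 1 else 0))"

text \<open>The decomposition of \<open>v\<close>, a function of \<open>(x\<^sub>j, ..., x\<^sub>d)\<close>; the modes are numbered from 1.\<close>

definition biorthogonal_decomposition ::
  "nat \<Rightarrow> (nat \<Rightarrow> real set) \<Rightarrow> nat \<Rightarrow> nat \<Rightarrow> (point \<Rightarrow> real) \<Rightarrow>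
   (nat \<Rightarrow> real) \<Rightarrow> (nat \<Rightarrow> point \<Rightarrow> real) \<Rightarrow> (nat \<Rightarrow> point \<Rightarrow> real) \<Rightarrow> bool" where
  "biorthogonal_decomposition k \<Omega> d j v lam \<psi> \<phi> \<longleftrightarrow>
     v \<in> Hk k \<Omega> {j..d} \<and>
     (\<forall>i\<ge>1. 0 \<le> lam i \<and> lam (Suc i) \<le> lam i) \<and>
     orthonormal_modes k \<Omega> {j} \<psi> \<and>
     orthonormal_modes k \<Omega> {j+1..d} \<phi> \<and>
     (\<forall>i\<ge>1. AE y in block_measure \<Omega> {j+1..d}. U_op k \<Omega> d j v (\<psi> i) y = lam i * \<phi> i y) \<and>
     (\<forall>i\<ge>1. AE x in block_measure \<Omega> {j}. U_adj k \<Omega> d j v (\<phi> i) x = lam i * \<psi> i x) \<and>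
     (\<lambda>N. Hk_norm k \<Omega> {j..d}
        (\<lambda>x. v x - (\<Sum>i=1..N. lam i * tensor_fun {j} {j+1..d} (\<psi> i) (\<phi> i) x))) \<longlonglongrightarrow> 0"

subsection \<open>Recursive (Tensor Train) decomposition\<close>

text \<open>
  The tuple \<open>(i\<^sub>1, ..., i\<^sub>j)\<close> is the list \<open>[i\<^sub>1, ..., i\<^sub>j]\<close>. For such a list \<open>is\<close>,
  \<open>lam is\<close> is \<open>\<lambda>\<close>, \<open>\<psi> is\<close> is the mode in the variable \<open>x\<^sub>j\<close>, and \<open>\<phi> is\<close> is the mode in the
  variables \<open>x\<^sub>j\<^sub>+\<^sub>1, ..., x\<^sub>d\<close> with these indices; \<open>\<phi> []\<close> is \<open>u\<close>, and for \<open>j = d - 1\<close>, \<open>\<phi> is\<close>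
  is the last factor, in the variable \<open>x\<^sub>d\<close>.
\<close>

definition TT_decomposition ::
  "nat \<Rightarrow> (nat \<Rightarrow> real set) \<Rightarrow> nat \<Rightarrow> (point \<Rightarrow> real) \<Rightarrow>
   (nat list \<Rightarrow> real) \<Rightarrow> (nat list \<Rightarrow> point \<Rightarrow> real) \<Rightarrow> (nat list \<Rightarrow> point \<Rightarrow> real) \<Rightarrow> bool" where
  "TT_decomposition k \<Omega> d u lam \<psi> \<phi> \<longleftrightarrow> \<phi> [] = u \<and>
     (\<forall>j\<in>{1..d-1}. \<forall>is. length is = j - 1 \<and> (\<forall>i\<in>set is. 1 \<le> i) \<longrightarrow>
        biorthogonal_decomposition k \<Omega> d j (\<phi> is)
          (\<lambda>i. lam (is @ [i])) (\<lambda>i. \<psi> (is @ [i])) (\<lambda>i. \<phi> (is @ [i])))"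

text \<open>
  The tuples \<open>(i\<^sub>1, ..., i\<^sub>m)\<close> with \<open>1 \<le> i\<^sub>l \<le> r\<^sub>l(i\<^sub>1, ..., i\<^sub>l\<^sub>-\<^sub>1)\<close> for all \<open>l\<close>, where
  \<open>r is\<close> is the truncation rank at level \<open>length is + 1\<close>.
\<close>

definition truncated_indices :: "(nat list \<Rightarrow> nat) \<Rightarrow> nat \<Rightarrow> nat list set" where
  "truncated_indices r m =
     {is. length is = m \<and> (\<forall>l<m. 1 \<le> is ! l \<and> is ! l \<le> r (take l is))}"

definition TT_truncation ::
  "nat \<Rightarrow> (nat list \<Rightarrow> nat) \<Rightarrow> (nat list \<Rightarrow> real) \<Rightarrow>
   (nat list \<Rightarrow> point \<Rightarrow> real) \<Rightarrow> (nat list \<Rightarrow> point \<Rightarrow> real) \<Rightarrow> point \<Rightarrow> real" where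
  "TT_truncation d r lam \<psi> \<phi> x = (\<Sum>is\<in>truncated_indices r (d - 1).
     (\<Prod>l=1..d-1. lam (take l is)) *
     (\<Prod>l=1..d-1. \<psi> (take l is) (restrict x {l})) * \<phi> is (restrict x {d}))"

end

theory Submission
  imports Defs "HOL-Computational_Algebra.Polynomial"
begin

text \<open>
  The error formula is Pythagoras' theorem, applied once per level. Let \<open>v\<close> have the bi-orthogonal
  decomposition \<open>\<Sum>i. lam i * (\<psi> i \<otimes> \<phi> i)\<close>, keep the first \<open>r\<close> terms, and replace in them \<open>\<phi> i\<close> by
  an approximation \<open>T i\<close>. The error consists of the discarded terms and of the terms
  \<open>lam i * (\<psi> i \<otimes> (\<phi> i - T i))\<close> with \<open>i \<le> r\<close>. In a tensor product norm these are pairwise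
  orthogonal, because the \<open>\<psi> i\<close> are orthonormal. Hence the squared error is the sum of \<open>(lam i)\<^sup>2\<close>
  over \<open>i > r\<close> plus the sum over \<open>i \<le> r\<close> of \<open>(lam i)\<^sup>2\<close> times the squared error of \<open>T i\<close>
  (\<open>biorthogonal_truncation_error\<close>, from the abstract \<open>perturbed_orthonormal_series\<close>). With \<open>T i\<close>
  the truncated expansion on the next level this is a recursion for the error (\<open>TT_tail_error\<close>).
  The right-hand side of the formula satisfies the same recursion (\<open>tail_sum_Suc\<close>), and the recursively
  truncated expansion is the multiple sum over all truncated multi-indices (\<open>TT_truncation_eq_tail\<close>).

  The analytic content is that the inner product on a block is a tensor product: it is bilinear, and
  on elementary tensors it is the product of the inner products of the factors
  (\<open>Hk_inner_tensor\<close>). Since \<open>weak_deriv\<close> chooses a representative, both facts need the uniqueness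
  of weak derivatives, that is, the fundamental lemma of the calculus of variations
  (\<open>fundamental_lemma\<close>). It is proved with explicit bumps built from \<open>exp (-1/x)\<close>: their products
  over the coordinates are test functions and approximate indicator functions of boxes, and boxes
  generate the \<open>\<sigma>\<close>-algebra. That the weak derivative of an elementary tensor is the tensor of the
  weak derivatives (\<open>is_weak_deriv_tensor\<close>) follows from Fubini's theorem, since a test function of
  all variables becomes a test function of one block when the variables of the other are frozen.
\<close>

section \<open>Blocks of variables\<close>

definition good_block :: "(nat \<Rightarrow> real set) \<Rightarrow> nat set \<Rightarrow> bool" where
  "good_block \<Omega> J \<longleftrightarrow> finite J \<and> (\<forall>j\<in>J. one_dim_domain (\<Omega> j))"

text \<open>
  The default \<open>UNIV\<close> makes every factor \<open>\<sigma>\<close>-finite, which the theory of products of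
  \<open>\<sigma>\<close>-finite measures demands of all indices, those outside the block included.
\<close>

definition side_measure :: "(nat \<Rightarrow> real set) \<Rightarrow> nat \<Rightarrow> real measure" where
  "side_measure \<Omega> j = restrict_space lborel (if one_dim_domain (\<Omega> j) then \<Omega> j else UNIV)"

lemma good_block_finite: "good_block \<Omega> J \<Longrightarrow> finite J"
  by (simp add: good_block_def)

lemma good_block_union: "good_block \<Omega> I \<Longrightarrow> good_block \<Omega> J \<Longrightarrow> good_block \<Omega> (I \<union> J)"
  by (auto simp: good_block_def)

lemma one_dim_domain_borel: "one_dim_domain S \<Longrightarrow> S \<in> sets borel"
  unfolding one_dim_domain_def
  by (simp add: is_interval_connected_1 real_interval_borel_measurable)

lemma product_sigma_finite_side: "product_sigma_finite (side_measure \<Omega>)"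
proof (rule product_sigma_finite.intro)
  fix j show "sigma_finite_measure (side_measure \<Omega> j)"
    unfolding side_measure_def
    by (rule sigma_finite_measure_restrict_space)
       (auto simp: one_dim_domain_borel lborel.sigma_finite_measure_axioms)
qed

lemma block_measure_eq: "good_block \<Omega> J \<Longrightarrow> block_measure \<Omega> J = PiM J (side_measure \<Omega>)"
  unfolding block_measure_def good_block_def side_measure_def by (intro PiM_cong) auto

lemma space_block: "space (block_measure \<Omega> J) = PiE J \<Omega>"
  by (simp add: block_measure_def space_PiM space_restrict_space)

lemma emeasure_side:
  assumes "one_dim_domain (\<Omega> j)" "A \<in> sets borel" "A \<subseteq> \<Omega> j"
  shows "A \<in> sets (side_measure \<Omega> j)" "emeasure (side_measure \<Omega> j) A = emeasure lborel A"
  using assms unfolding side_measure_def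
  by (auto simp: sets_restrict_space_iff one_dim_domain_borel emeasure_restrict_space)

lemma box_in_sets:
  assumes "good_block \<Omega> J" "\<And>j. j \<in> J \<Longrightarrow> A j \<in> sets borel" "\<And>j. j \<in> J \<Longrightarrow> A j \<subseteq> \<Omega> j"
  shows "PiE J A \<in> sets (block_measure \<Omega> J)"
    and "emeasure (block_measure \<Omega> J) (PiE J A) = (\<Prod>j\<in>J. emeasure lborel (A j))"
proof -
  interpret product_sigma_finite "side_measure \<Omega>" by (rule product_sigma_finite_side)
  have *: "\<And>j. j \<in> J \<Longrightarrow> A j \<in> sets (side_measure \<Omega> j)"
    "\<And>j. j \<in> J \<Longrightarrow> emeasure (side_measure \<Omega> j) (A j) = emeasure lborel (A j)"
    using assms emeasure_side by (auto simp: good_block_def)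
  show "PiE J A \<in> sets (block_measure \<Omega> J)"
    using assms(1) * by (simp add: block_measure_eq good_block_finite sets_PiM_I_finite)
  show "emeasure (block_measure \<Omega> J) (PiE J A) = (\<Prod>j\<in>J. emeasure lborel (A j))"
    using assms(1) * by (simp add: block_measure_eq good_block_finite emeasure_PiM)
qed

lemma measurable_coordinate:
  assumes "good_block \<Omega> J" "j \<in> J"
  shows "(\<lambda>x. x j) \<in> borel_measurable (block_measure \<Omega> J)"
proof -
  have "(\<lambda>x. x j) \<in> measurable (block_measure \<Omega> J) (side_measure \<Omega> j)"
    unfolding block_measure_eq[OF assms(1)] by (rule measurable_component_singleton[OF assms(2)])
  moreover have "(\<lambda>x. x) \<in> borel_measurable (side_measure \<Omega> j)"
    unfolding side_measure_def by (simp add: measurable_restrict_space1)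
  ultimately show ?thesis by (rule measurable_compose)
qed

text \<open>
  Points of a block are compared with the Borel \<open>\<sigma>\<close>-algebra of the full function space, where
  continuity lives: a coordinate outside the block is the constant \<open>undefined\<close>, so it is measurable.
\<close>

lemma measurable_ident_block:
  assumes "good_block \<Omega> J"
  shows "(\<lambda>x. x) \<in> borel_measurable (block_measure \<Omega> J)"
proof (rule measurable_coordinatewise_then_product)
  fix i show "(\<lambda>x. x i) \<in> borel_measurable (block_measure \<Omega> J)"
  proof (cases "i \<in> J")
    case True then show ?thesis by (rule measurable_coordinate[OF assms])
  next
    case False
    then have "(\<lambda>x. x i) \<in> borel_measurable (block_measure \<Omega> J) \<longleftrightarrow>
      (\<lambda>x. undefined :: real) \<in> borel_measurable (block_measure \<Omega> J)"
      by (intro measurable_cong) (simp add: space_block PiE_iff extensional_def)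
    then show ?thesis by simp
  qed
qed

text \<open>
  Tychonoff's theorem in the function space over all indices; the coordinates outside \<open>J\<close> range
  over the one-point set \<open>{undefined}\<close>.
\<close>

lemma compact_PiE_block:
  fixes S :: "nat \<Rightarrow> real set"
  assumes "\<And>j. j \<in> J \<Longrightarrow> compact (S j)"
  shows "compact (PiE J S)"
proof -
  have eq: "PiE J S = PiE UNIV (\<lambda>i. if i \<in> J then S i else {undefined})"
    by (auto simp: PiE_iff extensional_def split: if_splits) 
  have "compactin (product_topology (\<lambda>i. euclidean) UNIV) (PiE UNIV (\<lambda>i. if i \<in> J then S i else {undefined}))"
    unfolding compactin_PiE using assms by (auto simp: compactin_euclidean_iff)
  then show ?thesis unfolding eq by (simp add: euclidean_product_topology)
qed

lemma measurable_continuous_block: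
  fixes f :: "point \<Rightarrow> real"
  assumes "good_block \<Omega> J" "continuous_on (PiE J (\<lambda>_. UNIV)) f"
  shows "f \<in> borel_measurable (block_measure \<Omega> J)"
proof -
  have 1: "f \<in> borel_measurable (restrict_space borel (PiE J (\<lambda>_. UNIV)))"
    by (rule borel_measurable_continuous_on_restrict[OF assms(2)])
  have 2: "(\<lambda>x. x) \<in> measurable (block_measure \<Omega> J) (restrict_space borel (PiE J (\<lambda>_. UNIV)))"
    by (rule measurable_restrict_space2) (auto simp: space_block measurable_ident_block[OF assms(1)])
  show ?thesis using measurable_compose[OF 2 1] .
qed

section \<open>Square integrable functions\<close>

lemma square_integrable_mult:
  assumes "square_integrable \<Omega> J f" "square_integrable \<Omega> J g"
  shows "integrable (block_measure \<Omega> J) (\<lambda>x. f x * g x)"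
proof (rule Bochner_Integration.integrable_bound)
  show "integrable (block_measure \<Omega> J) (\<lambda>x. (f x)\<^sup>2 + (g x)\<^sup>2)"
    using assms by (auto simp: square_integrable_def)
  show "(\<lambda>x. f x * g x) \<in> borel_measurable (block_measure \<Omega> J)"
    using assms by (auto simp: square_integrable_def)
  have "\<bar>a * b\<bar> \<le> a\<^sup>2 + b\<^sup>2" for a b :: real
  proof -
    have "2 * (\<bar>a\<bar> * \<bar>b\<bar>) \<le> a\<^sup>2 + b\<^sup>2" using sum_squares_bound[of "\<bar>a\<bar>" "\<bar>b\<bar>"] by (simp add: mult.assoc)
    then show ?thesis unfolding abs_mult by (smt (verit) mult_nonneg_nonneg abs_ge_zero)
  qed
  then show "AE x in block_measure \<Omega> J. norm (f x * g x) \<le> norm ((f x)\<^sup>2 + (g x)\<^sup>2)"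
    by auto
qed

lemma square_integrable_scale:
  "square_integrable \<Omega> J f \<Longrightarrow> square_integrable \<Omega> J (\<lambda>x. c * f x)"
  by (auto simp: square_integrable_def power_mult_distrib)

lemma square_integrable_add:
  assumes f: "square_integrable \<Omega> J f" and g: "square_integrable \<Omega> J g"
  shows "square_integrable \<Omega> J (\<lambda>x. f x + g x)"
proof -
  have "integrable (block_measure \<Omega> J) (\<lambda>x. (f x)\<^sup>2 + (g x)\<^sup>2 + 2 * (f x * g x))"
    using f g square_integrable_mult[OF f g] by (auto simp: square_integrable_def)
  then show ?thesis
    using f g by (auto simp: square_integrable_def power2_sum mult.assoc)
qed

lemma square_integrable_indicator_box:
  assumes "good_block \<Omega> J" "\<And>j. j \<in> J \<Longrightarrow> A j \<in> sets borel" "\<And>j. j \<in> J \<Longrightarrow> A j \<subseteq> \<Omega> j"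
    "\<And>j. j \<in> J \<Longrightarrow> bounded (A j)"
  shows "square_integrable \<Omega> J (indicator (PiE J A))"
proof -
  have 1: "PiE J A \<in> sets (block_measure \<Omega> J)" by (rule box_in_sets(1)[OF assms(1-3)])
  have "emeasure lborel (A j) < \<infinity>" if "j \<in> J" for j
    using emeasure_bounded_finite[OF assms(4)[OF that]] by simp
  then have "(\<Prod>j\<in>J. emeasure lborel (A j)) < \<infinity>"
    by (induction J rule: infinite_finite_induct) (auto simp: ennreal_mult_less_top)
  then have "emeasure (block_measure \<Omega> J) (PiE J A) < \<infinity>"
    by (simp only: box_in_sets(2)[OF assms(1-3)])
  moreover have "(\<lambda>x. (indicator (PiE J A) x :: real)\<^sup>2) = indicator (PiE J A)"
    by (auto simp: indicator_def)
  ultimately show ?thesis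
    using 1 by (auto simp: square_integrable_def)
qed

section \<open>Fubini's theorem on a union of two blocks\<close>

lemma integral_block_union:
  fixes F :: "point \<Rightarrow> real"
  assumes "good_block \<Omega> I" "good_block \<Omega> J" "I \<inter> J = {}"
    "integrable (block_measure \<Omega> (I \<union> J)) F"
  shows "integral\<^sup>L (block_measure \<Omega> (I \<union> J)) F =
      (\<integral>x. \<integral>y. F (merge I J (x, y)) \<partial>block_measure \<Omega> J \<partial>block_measure \<Omega> I)"
    and "integral\<^sup>L (block_measure \<Omega> (I \<union> J)) F =
      (\<integral>y. \<integral>x. F (merge I J (x, y)) \<partial>block_measure \<Omega> I \<partial>block_measure \<Omega> J)"
proof -
  interpret product_sigma_finite "side_measure \<Omega>" by (rule product_sigma_finite_side)
  note eqs = block_measure_eq[OF assms(1)] block_measure_eq[OF assms(2)]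
    block_measure_eq[OF good_block_union[OF assms(1,2)]]
  show "integral\<^sup>L (block_measure \<Omega> (I \<union> J)) F =
      (\<integral>x. \<integral>y. F (merge I J (x, y)) \<partial>block_measure \<Omega> J \<partial>block_measure \<Omega> I)"
    using assms unfolding eqs by (intro product_integral_fold) (auto simp: good_block_finite)
  have "integral\<^sup>L (PiM (J \<union> I) (side_measure \<Omega>)) F =
      (\<integral>y. \<integral>x. F (merge J I (y, x)) \<partial>PiM I (side_measure \<Omega>) \<partial>PiM J (side_measure \<Omega>))"
    using assms unfolding eqs by (intro product_integral_fold) (auto simp: good_block_finite Un_commute)
  moreover have "merge J I (y, x) = merge I J (x, y)" for x y :: point
    using merge_commute[OF assms(3), of x y] by simp
  ultimately show "integral\<^sup>L (block_measure \<Omega> (I \<union> J)) F =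
      (\<integral>y. \<integral>x. F (merge I J (x, y)) \<partial>block_measure \<Omega> I \<partial>block_measure \<Omega> J)"
    unfolding eqs by (simp add: Un_commute)
qed

lemma tensor_fun_merge:
  assumes "I \<inter> J = {}" "x \<in> PiE I A" "y \<in> PiE J B"
  shows "tensor_fun I J f g (merge I J (x, y)) = f x * g y"
  using assms by (simp add: tensor_fun_def PiE_restrict)

text \<open>
  By Tonelli's theorem the integral of the square is the product of the two one-block integrals.
\<close>

lemma square_integrable_tensor:
  assumes I: "good_block \<Omega> I" and J: "good_block \<Omega> J" and IJ: "I \<inter> J = {}"
    and f: "square_integrable \<Omega> I f" and g: "square_integrable \<Omega> J g"
  shows "square_integrable \<Omega> (I \<union> J) (tensor_fun I J f g)"
proof -
  interpret product_sigma_finite "side_measure \<Omega>" by (rule product_sigma_finite_side)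
  note eqs = block_measure_eq[OF I] block_measure_eq[OF J] block_measure_eq[OF good_block_union[OF I J]]
  have r: "(\<lambda>x. restrict x I) \<in> measurable (block_measure \<Omega> (I \<union> J)) (block_measure \<Omega> I)"
    "(\<lambda>x. restrict x J) \<in> measurable (block_measure \<Omega> (I \<union> J)) (block_measure \<Omega> J)"
    unfolding eqs by (auto intro!: measurable_restrict_subset)
  have m: "f \<in> borel_measurable (block_measure \<Omega> I)" "g \<in> borel_measurable (block_measure \<Omega> J)"
    using f g by (auto simp: square_integrable_def)
  have meas: "tensor_fun I J f g \<in> borel_measurable (block_measure \<Omega> (I \<union> J))"
    unfolding tensor_fun_def
    by (intro borel_measurable_times measurable_compose[OF r(1) m(1)] measurable_compose[OF r(2) m(2)])
  have fin: "(\<integral>\<^sup>+x. ennreal ((f x)\<^sup>2) \<partial>block_measure \<Omega> I) < \<infinity>"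
    "(\<integral>\<^sup>+x. ennreal ((g x)\<^sup>2) \<partial>block_measure \<Omega> J) < \<infinity>"
    using f g by (auto simp: square_integrable_def integrable_iff_bounded)
  have "(\<integral>\<^sup>+z. ennreal ((tensor_fun I J f g z)\<^sup>2) \<partial>block_measure \<Omega> (I \<union> J)) =
     (\<integral>\<^sup>+x. \<integral>\<^sup>+y. ennreal ((tensor_fun I J f g (merge I J (x, y)))\<^sup>2)
        \<partial>block_measure \<Omega> J \<partial>block_measure \<Omega> I)"
    using meas I J IJ unfolding eqs by (intro product_nn_integral_fold) (auto simp: good_block_finite)
  also have "\<dots> = (\<integral>\<^sup>+x. \<integral>\<^sup>+y. ennreal ((f x)\<^sup>2) * ennreal ((g y)\<^sup>2)
        \<partial>block_measure \<Omega> J \<partial>block_measure \<Omega> I)"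
    by (intro nn_integral_cong)
       (simp add: space_block tensor_fun_merge[OF IJ] power_mult_distrib ennreal_mult)
  also have "\<dots> = (\<integral>\<^sup>+x. ennreal ((f x)\<^sup>2) * (\<integral>\<^sup>+y. ennreal ((g y)\<^sup>2) \<partial>block_measure \<Omega> J) \<partial>block_measure \<Omega> I)"
    using m by (intro nn_integral_cong nn_integral_cmult) auto
  also have "\<dots> = (\<integral>\<^sup>+x. ennreal ((f x)\<^sup>2) \<partial>block_measure \<Omega> I) * (\<integral>\<^sup>+y. ennreal ((g y)\<^sup>2) \<partial>block_measure \<Omega> J)"
    using m by (intro nn_integral_multc) auto
  also have "\<dots> < \<infinity>" using fin by (simp add: ennreal_mult_less_top)
  finally show ?thesis
    using meas by (auto simp: square_integrable_def integrable_iff_bounded)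
qed

lemma integral_tensor_mult:
  assumes I: "good_block \<Omega> I" and J: "good_block \<Omega> J" and IJ: "I \<inter> J = {}"
    and "square_integrable \<Omega> I f" "square_integrable \<Omega> J g"
      "square_integrable \<Omega> I f'" "square_integrable \<Omega> J g'"
  shows "(\<integral>z. tensor_fun I J f g z * tensor_fun I J f' g' z \<partial>block_measure \<Omega> (I \<union> J)) =
    (\<integral>x. f x * f' x \<partial>block_measure \<Omega> I) * (\<integral>y. g y * g' y \<partial>block_measure \<Omega> J)"
proof -
  have "integrable (block_measure \<Omega> (I \<union> J)) (\<lambda>z. tensor_fun I J f g z * tensor_fun I J f' g' z)"
    using assms by (intro square_integrable_mult square_integrable_tensor)
  then have "(\<integral>z. tensor_fun I J f g z * tensor_fun I J f' g' z \<partial>block_measure \<Omega> (I \<union> J)) =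
     (\<integral>x. \<integral>y. tensor_fun I J f g (merge I J (x, y)) * tensor_fun I J f' g' (merge I J (x, y))
        \<partial>block_measure \<Omega> J \<partial>block_measure \<Omega> I)"
    by (rule integral_block_union(1)[OF I J IJ])
  also have "\<dots> = (\<integral>x. \<integral>y. (f x * f' x) * (g y * g' y) \<partial>block_measure \<Omega> J \<partial>block_measure \<Omega> I)"
    by (intro Bochner_Integration.integral_cong refl) (simp add: space_block tensor_fun_merge[OF IJ])
  finally show ?thesis by simp
qed

section \<open>Test functions\<close>

lemma continuous_on_coordinate: "continuous_on S (\<lambda>x. x i :: real)"
  by (rule continuous_on_subset[OF continuous_on_product_coordinates]) simp

text \<open>
  The same compact set \<open>K\<close> serves for the derivative: its complement is open, so outside \<open>K\<close> the
  function vanishes along a whole neighbourhood on the coordinate line.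
\<close>

lemma test_function_partial_deriv:
  assumes "test_function \<Omega> J f" "j \<in> J"
  shows "test_function \<Omega> J (partial_deriv j f)"
proof -
  from assms obtain K where K: "compact K" "K \<subseteq> PiE J (\<lambda>j. interior (\<Omega> j))"
    and z: "\<And>x. x \<in> PiE J (\<lambda>_. UNIV) - K \<Longrightarrow> f x = 0"
    by (auto simp: test_function_def)
  have "partial_deriv j f x = 0" if x: "x \<in> PiE J (\<lambda>_. UNIV) - K" for x
  proof -
    have "open ((\<lambda>t. x(j := t)) -` (- K))"
    proof (rule open_vimage)
      show "open (- K)" using K(1) by (simp add: compact_imp_closed open_Compl)
      show "continuous_on UNIV (\<lambda>t. x(j := t))"
        proof (rule continuous_on_coordinatewise_then_product)
        show "continuous_on UNIV (\<lambda>t. (x(j := t)) i)" for i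
          by (cases "i = j") auto
      qed
    qed
    moreover have "x j \<in> (\<lambda>t. x(j := t)) -` (- K)" using x by simp
    ultimately have "eventually (\<lambda>t. t \<in> (\<lambda>t. x(j := t)) -` (- K)) (nhds (x j))"
      by (rule eventually_nhds_in_open)
    then have "eventually (\<lambda>t. f (x(j := t)) = 0) (nhds (x j))"
    proof (rule eventually_mono)
      fix t assume "t \<in> (\<lambda>t. x(j := t)) -` (- K)"
      moreover have "x(j := t) \<in> PiE J (\<lambda>_. UNIV)"
        using x assms(2) by (auto simp: PiE_iff extensional_def)
      ultimately show "f (x(j := t)) = 0" using z by simp
    qed
    then have "partial_deriv j f x = deriv (\<lambda>t. 0) (x j)"
      unfolding partial_deriv_def by (rule deriv_cong_ev) simp
    then show ?thesis by simp
  qed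
  moreover have "C_order n J (partial_deriv j f)" for n
  proof -
    have "C_order (Suc n) J f" using assms by (auto simp: test_function_def)
    then show ?thesis using assms(2) by simp
  qed
  ultimately show ?thesis using K by (auto simp: test_function_def)
qed

lemma test_function_iterated_deriv:
  assumes "test_function \<Omega> J f" "set js \<subseteq> J"
  shows "test_function \<Omega> J (fold (\<lambda>j. partial_deriv j ^^ \<alpha> j) js f)"
proof -
  have *: "test_function \<Omega> J ((partial_deriv j ^^ n) f)" if "test_function \<Omega> J f" "j \<in> J" for j n f
    by (induction n) (auto simp: that test_function_partial_deriv)
  show ?thesis using assms
    by (induction js arbitrary: f) (auto simp: *)
qed

lemma test_function_classical_deriv:
  assumes "test_function \<Omega> (I \<union> J) f" "finite I"
  shows "test_function \<Omega> (I \<union> J) (classical_deriv I \<alpha> f)"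
  unfolding classical_deriv_def using assms by (intro test_function_iterated_deriv) auto

lemma test_function_continuous: "test_function \<Omega> J f \<Longrightarrow> continuous_on (PiE J (\<lambda>_. UNIV)) f"
  unfolding test_function_def by (metis C_order.simps(1))

text \<open>
  A test function is bounded and vanishes outside the product of the projections of its compact
  support, a box of finite measure.
\<close>

lemma test_function_square_integrable:
  assumes J: "good_block \<Omega> J" and f: "test_function \<Omega> J f"
  shows "square_integrable \<Omega> J f"
proof -
  from f obtain K where K: "compact K" "K \<subseteq> PiE J (\<lambda>j. interior (\<Omega> j))"
    and z: "\<And>x. x \<in> PiE J (\<lambda>_. UNIV) - K \<Longrightarrow> f x = 0"
    by (auto simp: test_function_def)
  define P where "P = (\<lambda>j. (\<lambda>x. x j) ` K)"
  have P: "compact (P j)" for j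
    unfolding P_def by (intro compact_continuous_image K(1) continuous_on_coordinate)
  have KU: "K \<subseteq> PiE J (\<lambda>_. UNIV)" using K(2) by (auto simp: PiE_iff)
  have "compact (f ` K)"
    by (intro compact_continuous_image K(1) continuous_on_subset[OF test_function_continuous[OF f] KU])
  then obtain C where C: "\<And>x. x \<in> K \<Longrightarrow> \<bar>f x\<bar> \<le> C"
    by (meson compact_imp_bounded bounded_real image_eqI)
  have PO: "P j \<subseteq> \<Omega> j" if "j \<in> J" for j
    using K(2) that interior_subset unfolding P_def by (fastforce simp: PiE_iff)
  have box: "square_integrable \<Omega> J (indicator (PiE J P))"
    using P PO by (intro square_integrable_indicator_box[OF J])
      (auto simp: compact_imp_bounded compact_imp_closed borel_closed)
  have bd: "\<bar>f x\<bar> \<le> \<bar>C * indicator (PiE J P) x\<bar>" if "x \<in> PiE J \<Omega>" for x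
  proof (cases "x \<in> K")
    case True
    then have "x \<in> PiE J P" using KU by (auto simp: P_def PiE_iff)
    then show ?thesis using C[OF True] by simp
  next
    case False
    then have "f x = 0" using that by (intro z) (auto simp: PiE_iff)
    then show ?thesis by simp
  qed
  have m: "f \<in> borel_measurable (block_measure \<Omega> J)"
    by (rule measurable_continuous_block[OF J test_function_continuous[OF f]])
  have "integrable (block_measure \<Omega> J) (\<lambda>x. (f x)\<^sup>2)"
  proof (rule Bochner_Integration.integrable_bound)
    show "integrable (block_measure \<Omega> J) (\<lambda>x. (C * indicator (PiE J P) x)\<^sup>2)"
      using square_integrable_scale[OF box] by (simp add: square_integrable_def)
    show "AE x in block_measure \<Omega> J. norm ((f x)\<^sup>2) \<le> norm ((C * indicator (PiE J P) x)\<^sup>2)"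
      using bd by (intro AE_I2) (simp add: space_block power2_le_iff_abs_le abs_le_square_iff del: power_mult_distrib)
  qed (use m in auto)
  then show ?thesis using m by (simp add: square_integrable_def)
qed

section \<open>Test functions with some variables frozen\<close>

lemma merge_upd: "I \<inter> J = {} \<Longrightarrow> j \<in> J \<Longrightarrow> merge I J (x, y(j := t)) = (merge I J (x, y))(j := t)"
  by (auto simp: merge_def fun_eq_iff)

text \<open>
  Differentiation in the variables of \<open>J\<close> commutes with freezing those of \<open>I\<close>. Together with
  \<open>test_function_slice\<close> this lets the definition of a weak derivative on one block be applied
  under the integral sign over the other block.
\<close>

lemma partial_deriv_slice:
  assumes "I \<inter> J = {}" "j \<in> J"
  shows "partial_deriv j (\<lambda>y. \<Phi> (merge I J (x, y))) = (\<lambda>y. partial_deriv j \<Phi> (merge I J (x, y)))"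
  using assms by (auto simp: partial_deriv_def merge_upd)

lemma iterated_deriv_slice:
  assumes "I \<inter> J = {}" "set js \<subseteq> J"
  shows "fold (\<lambda>j. partial_deriv j ^^ \<alpha> j) js (\<lambda>y. \<Phi> (merge I J (x, y))) =
    (\<lambda>y. fold (\<lambda>j. partial_deriv j ^^ \<alpha> j) js \<Phi> (merge I J (x, y)))"
proof -
  have *: "(partial_deriv j ^^ n) (\<lambda>y. \<Phi> (merge I J (x, y))) =
      (\<lambda>y. (partial_deriv j ^^ n) \<Phi> (merge I J (x, y)))" if "j \<in> J" for j n \<Phi>
    by (induction n) (auto simp: partial_deriv_slice[OF assms(1) that])
  show ?thesis using assms(2)
    by (induction js arbitrary: \<Phi>) (auto simp: *)
qed

lemma classical_deriv_slice:
  assumes "I \<inter> J = {}" "finite J"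
  shows "classical_deriv J \<alpha> (\<lambda>y. \<Phi> (merge I J (x, y))) = (\<lambda>y. classical_deriv J \<alpha> \<Phi> (merge I J (x, y)))"
  unfolding classical_deriv_def using assms by (intro iterated_deriv_slice) auto

lemma continuous_merge: "continuous_on S (\<lambda>y. merge I J (x, y) :: point)"
  proof (rule continuous_on_coordinatewise_then_product)
  show "continuous_on S (\<lambda>y. merge I J (x, y) i)" for i
    by (cases "i \<in> I"; cases "i \<in> J") (simp_all add: merge_def continuous_on_coordinate)
qed

lemma C_order_slice:
  assumes "I \<inter> J = {}" "x \<in> PiE I (\<lambda>_. UNIV)"
  shows "C_order n (I \<union> J) \<Phi> \<Longrightarrow> C_order n J (\<lambda>y. \<Phi> (merge I J (x, y)))"
proof (induction n arbitrary: \<Phi>)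
  case 0
  have "merge I J (x, y) \<in> PiE (I \<union> J) (\<lambda>_. UNIV)" for y :: point
    using assms(1) by simp
  then have "continuous_on (PiE J (\<lambda>_. UNIV)) (\<Phi> \<circ> (\<lambda>y. merge I J (x, y)))"
    using 0 by (intro continuous_on_compose continuous_merge) (auto elim!: continuous_on_subset)
  then show ?case by (simp add: o_def)
next
  case (Suc n)
  have m: "merge I J (x, y) \<in> PiE (I \<union> J) (\<lambda>_. UNIV)" for y :: point
    using assms(1) by simp
  have "continuous_on (PiE J (\<lambda>_. UNIV)) (\<Phi> \<circ> (\<lambda>y. merge I J (x, y)))"
    using Suc.prems m by (intro continuous_on_compose continuous_merge) (auto elim!: continuous_on_subset)
  moreover have "(\<lambda>t. \<Phi> (merge I J (x, y(j := t)))) field_differentiable at (y j)" if j: "j \<in> J" for y j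
  proof -
    have "(\<lambda>t. \<Phi> ((merge I J (x, y))(j := t))) field_differentiable at (merge I J (x, y) j)"
      using Suc.prems m j by (auto simp del: PiE_cancel_merge)
    then show ?thesis using j assms(1) by (simp add: merge_upd)
  qed
  moreover have "C_order n J (partial_deriv j (\<lambda>y. \<Phi> (merge I J (x, y))))" if "j \<in> J" for j
    unfolding partial_deriv_slice[OF assms(1) that] using Suc.prems that by (intro Suc.IH) simp
  ultimately show ?case by (simp add: o_def)
qed

text \<open>
  The support of a slice lies in the projection of the support of \<open>\<Phi>\<close> to the remaining variables.
\<close>

lemma test_function_slice:
  assumes IJ: "I \<inter> J = {}" and x: "x \<in> PiE I (\<lambda>_. UNIV)" and \<Phi>: "test_function \<Omega> (I \<union> J) \<Phi>"
  shows "test_function \<Omega> J (\<lambda>y. \<Phi> (merge I J (x, y)))"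
proof -
  from \<Phi> obtain K where K: "compact K" "K \<subseteq> PiE (I \<union> J) (\<lambda>j. interior (\<Omega> j))"
    and z: "\<And>x. x \<in> PiE (I \<union> J) (\<lambda>_. UNIV) - K \<Longrightarrow> \<Phi> x = 0"
    by (auto simp: test_function_def)
  have "continuous_on K (\<lambda>x. restrict x J :: point)"
  proof (rule continuous_on_coordinatewise_then_product)
    show "continuous_on K (\<lambda>x. restrict x J i)" for i
      by (cases "i \<in> J") (simp_all add: continuous_on_coordinate)
  qed
  then have "compact ((\<lambda>x. restrict x J) ` K)" using K(1) by (rule compact_continuous_image)
  moreover have "(\<lambda>x. restrict x J) ` K \<subseteq> PiE J (\<lambda>j. interior (\<Omega> j))"
    using K(2) by (auto simp: PiE_iff)
  moreover have "\<Phi> (merge I J (x, y)) = 0"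
    if "y \<in> PiE J (\<lambda>_. UNIV) - (\<lambda>x. restrict x J) ` K" for y
  proof (rule z)
    have "restrict (merge I J (x, y)) J = y" using that IJ by (auto simp: PiE_def extensional_restrict)
    then have "merge I J (x, y) \<notin> K" using that by (metis DiffD2 image_eqI)
    then show "merge I J (x, y) \<in> PiE (I \<union> J) (\<lambda>_. UNIV) - K" using IJ by simp
  qed
  moreover have "C_order n J (\<lambda>y. \<Phi> (merge I J (x, y)))" for n
    using \<Phi> by (intro C_order_slice[OF IJ x]) (simp add: test_function_def)
  ultimately show ?thesis
    unfolding test_function_def by (intro conjI allI exI[of _ "(\<lambda>x. restrict x J) ` K"] ballI)
qed

section \<open>Smooth bump functions\<close>

text \<open>
  The functions \<open>p (1/x) exp (-1/x)\<close>, extended by \<open>0\<close> to \<open>x \<le> 0\<close>, with \<open>p\<close> a polynomial. The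
  family contains the classical flat function (\<open>p = 1\<close>) and is closed under differentiation,
  so all its members are smooth.
\<close>

definition flat :: "real poly \<Rightarrow> real \<Rightarrow> real" where
  "flat p x = (if x \<le> 0 then 0 else poly p (1 / x) * exp (- (1 / x)))"

lemma poly_times_exp_tendsto_0: "((\<lambda>y. poly p y * exp (- y)) \<longlongrightarrow> (0::real)) at_top"
proof -
  have "((\<lambda>y. \<Sum>i\<le>degree p. coeff p i * (y ^ i / exp y)) \<longlongrightarrow> (\<Sum>i\<le>degree p. coeff p i * 0)) at_top"
    by (intro tendsto_intros tendsto_power_div_exp_0)
  moreover have "(\<lambda>y. poly p y * exp (- y)) = (\<lambda>y. \<Sum>i\<le>degree p. coeff p i * (y ^ i / exp y))"
    by (simp add: poly_altdef exp_minus sum_distrib_right divide_inverse mult.assoc fun_eq_iff)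
  ultimately show ?thesis by simp
qed

lemma flat_tendsto_0: "(flat p \<longlongrightarrow> 0) (at 0)"
proof -
  have "((\<lambda>x. poly p (inverse x) * exp (- inverse x)) \<longlongrightarrow> 0) (at_right 0)"
    by (rule filterlim_compose[OF poly_times_exp_tendsto_0 filterlim_inverse_at_top_right])
  moreover have "eventually (\<lambda>x. poly p (inverse x) * exp (- inverse x) = flat p x) (at_right 0)"
    by (auto simp: eventually_at_filter flat_def inverse_eq_divide)
  ultimately have "(flat p \<longlongrightarrow> 0) (at_right 0)" by (rule Lim_transform_eventually)
  moreover have "(flat p \<longlongrightarrow> 0) (at_left 0)"
    by (rule Lim_transform_eventually[OF tendsto_const]) (auto simp: eventually_at_filter flat_def)
  ultimately show ?thesis by (simp add: filterlim_split_at)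
qed

text \<open>
  At \<open>x = 0\<close> the difference quotient of \<open>flat p\<close> is \<open>flat\<close> of \<open>y p(y)\<close>, which tends to \<open>0\<close>; for
  \<open>x > 0\<close> the factor \<open>y\<^sup>2\<close> with \<open>y = 1/x\<close> comes from the derivative of \<open>1/x\<close>.
\<close>

lemma flat_has_derivative:
  "(flat p has_real_derivative flat (monom 1 2 * (p - pderiv p)) x) (at x)"
proof -
  consider "x < 0" | "x = 0" | "x > 0" by linarith
  then show ?thesis
  proof cases
    case 1
    have "((\<lambda>x. 0) has_real_derivative 0) (at x)" by simp
    then have "(flat p has_real_derivative 0) (at x)"
      by (rule has_field_derivative_transform_within_open[where S = "{..<0}"])
         (use 1 in \<open>auto simp: flat_def\<close>)
    then show ?thesis using 1 by (simp add: flat_def)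
  next
    case 2
    have "flat p h / h = flat (monom 1 1 * p) h" for h
      by (simp add: flat_def poly_monom)
    then have "((\<lambda>h. flat p h / h) \<longlongrightarrow> 0) (at 0)" using flat_tendsto_0[of "monom 1 1 * p"] by simp
    then show ?thesis using 2 by (simp add: DERIV_def flat_def)
  next
    case 3
    have "((\<lambda>x. poly p (1 / x) * exp (- (1 / x))) has_real_derivative
        poly (monom 1 2 * (p - pderiv p)) (1 / x) * exp (- (1 / x))) (at x)"
      using 3 by (auto intro!: derivative_eq_intros DERIV_chain2[OF poly_DERIV]
          simp: poly_monom field_simps power2_eq_square)
    then have "(flat p has_real_derivative
        poly (monom 1 2 * (p - pderiv p)) (1 / x) * exp (- (1 / x))) (at x)"
      by (rule has_field_derivative_transform_within_open[where S = "{0<..}"])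
         (use 3 in \<open>auto simp: flat_def\<close>)
    then show ?thesis using 3 by (simp add: flat_def)
  qed
qed

text \<open>
  A family of functions, vanishing outside \<open>{a<..<b}\<close> when \<open>m > 0\<close>, that contains the bumps below and is closed
  under differentiation; sums are included because of the product rule.
\<close>

inductive_set window_functions :: "real \<Rightarrow> real \<Rightarrow> real \<Rightarrow> (real \<Rightarrow> real) set" for a b m where
  basic: "(\<lambda>x. c * (flat p (m * (x - a)) * flat q (m * (b - x)))) \<in> window_functions a b m"
| add: "f \<in> window_functions a b m \<Longrightarrow> g \<in> window_functions a b m \<Longrightarrow>
    (\<lambda>x. f x + g x) \<in> window_functions a b m"

lemma window_functions_derivative:
  "f \<in> window_functions a b m \<Longrightarrow>
    \<exists>f'\<in>window_functions a b m. \<forall>x. (f has_real_derivative f' x) (at x)"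
proof (induction rule: window_functions.induct)
  case (basic c p q)
  define p' q' where "p' = monom 1 2 * (p - pderiv p)" and "q' = monom 1 2 * (q - pderiv q)"
  have "((\<lambda>x. c * (flat p (m * (x - a)) * flat q (m * (b - x)))) has_real_derivative
      (c * m) * (flat p' (m * (x - a)) * flat q (m * (b - x))) +
      (- c * m) * (flat p (m * (x - a)) * flat q' (m * (b - x)))) (at x)" for x
    unfolding p'_def q'_def
    by (auto intro!: derivative_eq_intros DERIV_chain2[OF flat_has_derivative] simp: algebra_simps)
  then show ?case
    by (intro bexI[OF _ window_functions.add[OF window_functions.basic window_functions.basic]]) blast
next
  case (add f g)
  then obtain f' g' where "f' \<in> window_functions a b m" "g' \<in> window_functions a b m"
    "\<And>x. (f has_real_derivative f' x) (at x)" "\<And>x. (g has_real_derivative g' x) (at x)" by blast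
  then show ?case
    by (intro bexI[of _ "\<lambda>x. f' x + g' x"] window_functions.add allI DERIV_add)
qed

text \<open>
  The partial derivative of a product of one-variable functions is again such a product, with one
  factor differentiated. So it is enough that each factor belongs to a family closed under
  differentiation, and no higher derivative has to be computed.
\<close>

lemma C_order_product:
  assumes J: "finite J"
    and W: "\<And>j f. j \<in> J \<Longrightarrow> f \<in> W j \<Longrightarrow> \<exists>f'\<in>W j. \<forall>x. (f has_real_derivative f' x) (at x)"
  shows "(\<And>j. j \<in> J \<Longrightarrow> b j \<in> W j) \<Longrightarrow> C_order n J (\<lambda>x. \<Prod>j\<in>J. b j (x j))"
proof (induction n arbitrary: b)
  have cont: "continuous_on (PiE J (\<lambda>_. UNIV)) (\<lambda>x. \<Prod>j\<in>J. b j (x j))"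
    if b: "\<And>j. j \<in> J \<Longrightarrow> b j \<in> W j" for b
  proof (rule continuous_on_prod)
    fix j assume "j \<in> J"
    then have "continuous_on UNIV (b j)"
      using W[OF _ b] by (meson DERIV_continuous continuous_at_imp_continuous_on)
    then show "continuous_on (PiE J (\<lambda>_. UNIV)) (\<lambda>x. b j (x j))"
      by (rule continuous_on_compose2[OF _ continuous_on_coordinate]) auto
  qed
  case 0
  show ?case using cont[OF 0] by simp
  case (Suc n)
  have 1: "((\<lambda>t. \<Prod>i\<in>J. b i ((x(j := t)) i)) has_real_derivative (\<Prod>i\<in>J. (b(j := b')) i (x i))) (at (x j))"
    if j: "j \<in> J" and b': "\<And>x. (b j has_real_derivative b' x) (at x)" for j x b'
  proof -
    have "(\<Prod>i\<in>J. b i ((x(j := t)) i)) = b j t * (\<Prod>i\<in>J - {j}. b i (x i))" for t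
      using j J by (simp add: prod.remove)
    moreover have "(\<Prod>i\<in>J. (b(j := b')) i (x i)) = b' (x j) * (\<Prod>i\<in>J - {j}. b i (x i))"
      using j J by (simp add: prod.remove)
    ultimately show ?thesis using DERIV_cmult_right[OF b'] by simp
  qed
  have "(\<lambda>t. \<Prod>i\<in>J. b i ((x(j := t)) i)) field_differentiable at (x j)"
    "C_order n J (partial_deriv j (\<lambda>x. \<Prod>j\<in>J. b j (x j)))" if j: "j \<in> J" for j x
  proof -
    obtain b' where b': "b' \<in> W j" "\<And>x. (b j has_real_derivative b' x) (at x)"
      using W[OF j Suc.prems[OF j]] by blast
    show "(\<lambda>t. \<Prod>i\<in>J. b i ((x(j := t)) i)) field_differentiable at (x j)"
      using 1[OF j b'(2)] unfolding field_differentiable_def by blast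
    have "partial_deriv j (\<lambda>x. \<Prod>j\<in>J. b j (x j)) = (\<lambda>x. \<Prod>i\<in>J. (b(j := b')) i (x i))"
      unfolding partial_deriv_def by (rule ext, rule DERIV_imp_deriv, rule 1[OF j b'(2)])
    then show "C_order n J (partial_deriv j (\<lambda>x. \<Prod>j\<in>J. b j (x j)))"
      using Suc.IH[of "b(j := b')"] Suc.prems b'(1) by simp
  qed
  then show ?case using cont[OF Suc.prems] by simp
qed

text \<open>
  Since \<open>flat 1 (m y) = exp (-1/(m y))\<close> increases to \<open>1\<close> for \<open>y > 0\<close> as \<open>m\<close> grows, these bumps tend
  to the indicator function of \<open>{a<..<b}\<close> without any normalisation.
\<close>

definition bump :: "real \<Rightarrow> real \<Rightarrow> real \<Rightarrow> real \<Rightarrow> real" where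
  "bump a b m x = flat 1 (m * (x - a)) * flat 1 (m * (b - x))"

lemma bump_bounds: "0 \<le> bump a b m x" "bump a b m x \<le> 1"
  by (auto simp: bump_def flat_def mult_le_one)

lemma bump_outside: "0 < m \<Longrightarrow> x \<notin> {a<..<b} \<Longrightarrow> bump a b m x = 0"
  by (auto simp: bump_def flat_def mult_le_0_iff not_less)

lemma flat_tendsto_1:
  assumes "0 < y" shows "(\<lambda>n. flat 1 (real (Suc n) * y)) \<longlonglongrightarrow> 1"
proof -
  have "(\<lambda>n. exp (- (inverse (real (Suc n)) * (1 / y)))) \<longlonglongrightarrow> exp (- (0 * (1 / y)))"
    by (intro tendsto_intros LIMSEQ_inverse_real_of_nat)
  moreover have "flat 1 (real (Suc n) * y) = exp (- (inverse (real (Suc n)) * (1 / y)))" for n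
    using assms mult_pos_pos[of "real (Suc n)" y] by (simp add: flat_def field_simps)
  ultimately show ?thesis by simp
qed

lemma bump_tendsto_1: "x \<in> {a<..<b} \<Longrightarrow> (\<lambda>n. bump a b (real (Suc n)) x) \<longlonglongrightarrow> 1"
  unfolding bump_def using tendsto_mult[OF flat_tendsto_1[of "x - a"] flat_tendsto_1[of "b - x"]] by simp

lemma test_function_bump:
  assumes "finite J" "0 < m" "\<And>j. j \<in> J \<Longrightarrow> {a j..b j} \<subseteq> interior (\<Omega> j)"
  shows "test_function \<Omega> J (\<lambda>x. \<Prod>j\<in>J. bump (a j) (b j) m (x j))"
  unfolding test_function_def
proof (intro conjI allI exI[of _ "PiE J (\<lambda>j. {a j..b j})"] ballI)
  show "C_order n J (\<lambda>x. \<Prod>j\<in>J. bump (a j) (b j) m (x j))" for n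
  proof (rule C_order_product[OF assms(1), where W = "\<lambda>j. window_functions (a j) (b j) m"])
    show "bump (a j) (b j) m \<in> window_functions (a j) (b j) m" for j
      using window_functions.basic[of 1 1 m "a j" 1 "b j"] by (simp add: bump_def[abs_def])
  qed (rule window_functions_derivative)
  show "compact (PiE J (\<lambda>j. {a j..b j}))" by (intro compact_PiE_block) simp
  show "PiE J (\<lambda>j. {a j..b j}) \<subseteq> PiE J (\<lambda>j. interior (\<Omega> j))"
    using assms(3) by (intro PiE_mono)
  fix x assume x: "x \<in> PiE J (\<lambda>_. UNIV) - PiE J (\<lambda>j. {a j..b j})"
  then obtain j where "j \<in> J" "x j \<notin> {a j..b j}" by (auto simp: PiE_iff)
  then have "j \<in> J" "bump (a j) (b j) m (x j) = 0" using assms(2) by (auto intro: bump_outside)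
  then show "(\<Prod>j\<in>J. bump (a j) (b j) m (x j)) = 0" using assms(1) by (auto intro: prod_zero)
qed

section \<open>The fundamental lemma of the calculus of variations\<close>

text \<open>
  Products of bumps are test functions that converge boundedly to the indicator function of the box;
  the claim is the limit, by dominated convergence.
\<close>

lemma integral_box_eq_0:
  assumes J: "good_block \<Omega> J" and h: "square_integrable \<Omega> J h"
    and z: "\<And>\<phi>. test_function \<Omega> J \<phi> \<Longrightarrow> (\<integral>x. h x * \<phi> x \<partial>block_measure \<Omega> J) = 0"
    and ab: "\<And>j. j \<in> J \<Longrightarrow> {a j..b j} \<subseteq> interior (\<Omega> j)"
  shows "integrable (block_measure \<Omega> J) (\<lambda>x. h x * indicator (PiE J (\<lambda>j. {a j<..<b j})) x)"
    and "(\<integral>x. h x * indicator (PiE J (\<lambda>j. {a j<..<b j})) x \<partial>block_measure \<Omega> J) = 0"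
proof -
  let ?B = "PiE J (\<lambda>j. {a j<..<b j})"
  let ?w = "\<lambda>n x. \<Prod>j\<in>J. bump (a j) (b j) (real (Suc n)) (x j)"
  have fin: "finite J" using J by (rule good_block_finite)
  have sub: "{a j<..<b j} \<subseteq> \<Omega> j" if "j \<in> J" for j
    using ab[OF that] interior_subset[of "\<Omega> j"] greaterThanLessThan_subseteq_atLeastAtMost_iff[of "a j" "b j" "a j" "b j"]
    by force
  have B: "square_integrable \<Omega> J (indicator ?B)"
    using sub by (intro square_integrable_indicator_box[OF J]) auto
  show int: "integrable (block_measure \<Omega> J) (\<lambda>x. h x * indicator ?B x)"
    by (rule square_integrable_mult[OF h B])
  have t: "test_function \<Omega> J (?w n)" for n by (rule test_function_bump[OF fin _ ab]) auto
  have w: "square_integrable \<Omega> J (?w n)" for n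
    by (rule test_function_square_integrable[OF J t])
  have out: "?w n x = 0" if "x \<notin> ?B" "x \<in> PiE J \<Omega>" for n x
  proof -
    from that obtain j where "j \<in> J" "x j \<notin> {a j<..<b j}" by (auto simp: PiE_iff)
    then have "j \<in> J" "bump (a j) (b j) (real (Suc n)) (x j) = 0" by (auto intro: bump_outside)
    then show ?thesis using fin by (auto intro: prod_zero)
  qed
  have "(\<lambda>n. \<integral>x. h x * ?w n x \<partial>block_measure \<Omega> J) \<longlonglongrightarrow> (\<integral>x. h x * indicator ?B x \<partial>block_measure \<Omega> J)"
  proof (rule integral_dominated_convergence)
    show "integrable (block_measure \<Omega> J) (\<lambda>x. \<bar>h x * indicator ?B x\<bar>)"
      using int by (rule integrable_abs)
    show "(\<lambda>x. h x * indicator ?B x) \<in> borel_measurable (block_measure \<Omega> J)"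
      using int by (rule borel_measurable_integrable)
    show "(\<lambda>x. h x * ?w n x) \<in> borel_measurable (block_measure \<Omega> J)" for n
      by (rule borel_measurable_integrable[OF square_integrable_mult[OF h w]])
    show "AE x in block_measure \<Omega> J. (\<lambda>n. h x * ?w n x) \<longlonglongrightarrow> h x * indicator ?B x"
    proof (rule AE_I2)
      fix x assume x: "x \<in> space (block_measure \<Omega> J)"
      have "(\<lambda>n. ?w n x) \<longlonglongrightarrow> indicator ?B x"
      proof (cases "x \<in> ?B")
        case True
        then have "(\<lambda>n. bump (a j) (b j) (real (Suc n)) (x j)) \<longlonglongrightarrow> 1" if "j \<in> J" for j
          using that by (intro bump_tendsto_1) (simp add: PiE_iff)
        then have "(\<lambda>n. ?w n x) \<longlonglongrightarrow> (\<Prod>j\<in>J. 1)" by (rule tendsto_prod)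
        then show ?thesis using True by simp
      next
        case False
        then show ?thesis using x out by (simp add: space_block)
      qed
      then show "(\<lambda>n. h x * ?w n x) \<longlonglongrightarrow> h x * indicator ?B x" by (rule tendsto_mult_left)
    qed
    show "AE x in block_measure \<Omega> J. norm (h x * ?w n x) \<le> \<bar>h x * indicator ?B x\<bar>" for n
    proof (rule AE_I2)
      fix x assume x: "x \<in> space (block_measure \<Omega> J)"
      show "norm (h x * ?w n x) \<le> \<bar>h x * indicator ?B x\<bar>"
      proof (cases "x \<in> ?B")
        case True
        have "\<bar>?w n x\<bar> \<le> 1" unfolding abs_prod using bump_bounds by (intro prod_le_1) simp
        then have "\<bar>h x\<bar> * \<bar>?w n x\<bar> \<le> \<bar>h x\<bar> * 1" by (rule mult_left_mono) simp
        then show ?thesis using True by (simp add: abs_mult)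
      next
        case False
        then show ?thesis using x out by (simp add: space_block)
      qed
    qed
  qed
  moreover have "(\<integral>x. h x * ?w n x \<partial>block_measure \<Omega> J) = 0" for n by (rule z[OF t])
  ultimately show "(\<integral>x. h x * indicator ?B x \<partial>block_measure \<Omega> J) = 0"
    by (simp add: LIMSEQ_const_iff)
qed

lemma sets_block_generated_by_boxes:
  assumes "good_block \<Omega> J"
  shows "sets (block_measure \<Omega> J) =
    sigma_sets (PiE J \<Omega>) {PiE J (\<lambda>j. \<Omega> j \<inter> {a j<..<b j}) | a b. True}"
proof -
  have box_eq: "{f\<in>PiE J \<Omega>. \<forall>i\<in>J. f i \<in> \<Omega> i \<inter> S i} = PiE J (\<lambda>i. \<Omega> i \<inter> S i)" for S
    by (rule set_eqI) (auto simp only: PiE_iff mem_Collect_eq Int_iff)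
  define E where "E = (\<lambda>j. {\<Omega> j \<inter> {a<..<b} | a b. True})"
  have "sets (restrict_space lborel (\<Omega> j)) = sets (sigma (\<Omega> j) (E j))" if j: "j \<in> J" for j
  proof -
    let ?G = "range (\<lambda>(a, b). {a<..<b::real})"
    have b: "sets borel = sigma_sets UNIV ?G"
      using arg_cong[OF borel_eq_box[where 'a = real], of sets] by (simp add: box_real)
    have "\<Omega> j \<in> sigma_sets UNIV ?G"
      using assms j one_dim_domain_borel unfolding b[symmetric] by (auto simp: good_block_def)
    then have "(\<inter>) (\<Omega> j) ` sigma_sets UNIV ?G = sigma_sets (\<Omega> j) ((\<inter>) (\<Omega> j) ` ?G)"
      by (rule sigma_sets_Int) simp
    moreover have "(\<inter>) (\<Omega> j) ` ?G = E j" by (auto simp: E_def)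
    moreover have "E j \<subseteq> Pow (\<Omega> j)" by (auto simp: E_def)
    ultimately show ?thesis by (simp add: sets_restrict_space b)
  qed
  then have "sets (block_measure \<Omega> J) = sets (PiM J (\<lambda>j. sigma (\<Omega> j) (E j)))"
    unfolding block_measure_def by (intro sets_PiM_cong) auto
  also have "\<dots> = sets (sigma (PiE J \<Omega>) {{f\<in>PiE J \<Omega>. \<forall>i\<in>j. f i \<in> A i} | A j. j \<in> {J} \<and> A \<in> Pi j E})"
  proof (rule sets_PiM_sigma)
    show "\<exists>S\<subseteq>E i. countable S \<and> \<Omega> i = \<Union> S" if "i \<in> J" for i
    proof (intro exI conjI)
      show "range (\<lambda>n. \<Omega> i \<inter> {- real n<..<real n}) \<subseteq> E i" by (auto simp: E_def)
      show "\<Omega> i = \<Union> (range (\<lambda>n. \<Omega> i \<inter> {- real n<..<real n}))"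
      proof safe
        fix x assume "x \<in> \<Omega> i"
        obtain n where "\<bar>x\<bar> < real n" using reals_Archimedean2 by blast
        then show "x \<in> \<Union> (range (\<lambda>n. \<Omega> i \<inter> {- real n<..<real n}))"
          using \<open>x \<in> \<Omega> i\<close> by (auto intro!: exI[of _ n])
      qed
    qed simp
  qed (use assms in \<open>auto simp: E_def good_block_finite\<close>)
  also have "{{f\<in>PiE J \<Omega>. \<forall>i\<in>j. f i \<in> A i} | A j. j \<in> {J} \<and> A \<in> Pi j E} =
      {PiE J (\<lambda>j. \<Omega> j \<inter> {a j<..<b j}) | a b. True}" (is "?L = ?R")
  proof (intro equalityI subsetI)
    fix X assume "X \<in> ?L"
    then obtain A where X: "X = {f\<in>PiE J \<Omega>. \<forall>i\<in>J. f i \<in> A i}" and A: "A \<in> Pi J E" by auto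
    have "\<forall>j\<in>J. \<exists>p q. A j = \<Omega> j \<inter> {p<..<q}" using A by (auto simp: E_def Pi_iff)
    then obtain p q where pq: "\<And>j. j \<in> J \<Longrightarrow> A j = \<Omega> j \<inter> {p j<..<q j}" by metis
    have "X = {f\<in>PiE J \<Omega>. \<forall>i\<in>J. f i \<in> \<Omega> i \<inter> {p i<..<q i}}"
      unfolding X by (simp add: pq cong: ball_cong)
    then have "X = PiE J (\<lambda>j. \<Omega> j \<inter> {p j<..<q j})" by (simp only: box_eq)
    then show "X \<in> ?R" by blast
  next
    fix X assume "X \<in> ?R"
    then obtain p q where "X = PiE J (\<lambda>j. \<Omega> j \<inter> {p j<..<q j})" by blast
    then have "X = {f\<in>PiE J \<Omega>. \<forall>i\<in>J. f i \<in> \<Omega> i \<inter> {p i<..<q i}}" by (simp only: box_eq)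
    moreover have "(\<lambda>i. \<Omega> i \<inter> {p i<..<q i}) \<in> Pi J E" by (auto simp: E_def)
    ultimately show "X \<in> ?L"
      by (intro CollectI exI[of _ "\<lambda>i. \<Omega> i \<inter> {p i<..<q i}"] exI[of _ J]) simp
  qed
  finally show ?thesis
    by (subst (asm) sets_measure_of) (auto simp: PiE_iff)
qed

text \<open>
  The signed measure with density \<open>h\<close> restricted to the box is finite and vanishes on all boxes,
  because the intersection of two boxes is a box. Boxes generate the \<open>\<sigma>\<close>-algebra, so by Dynkin's
  theorem it vanishes on \<open>{h > 0}\<close> and on \<open>{h < 0}\<close>.
\<close>

lemma AE_0_on_box:
  assumes J: "good_block \<Omega> J" and h: "square_integrable \<Omega> J h"
    and z: "\<And>\<phi>. test_function \<Omega> J \<phi> \<Longrightarrow> (\<integral>x. h x * \<phi> x \<partial>block_measure \<Omega> J) = 0"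
    and cd: "\<And>j. j \<in> J \<Longrightarrow> {c j..d j} \<subseteq> interior (\<Omega> j)"
  shows "AE x in block_measure \<Omega> J. x \<in> PiE J (\<lambda>j. {c j<..<d j}) \<longrightarrow> h x = 0"
proof -
  let ?M = "block_measure \<Omega> J"
  define g where "g = (\<lambda>x. h x * indicator (PiE J (\<lambda>j. {c j<..<d j})) x)"
  define G where "G = {PiE J (\<lambda>j. \<Omega> j \<inter> {a j<..<b j}) | a b. True}"
  have box: "integrable ?M (\<lambda>x. h x * indicator (PiE J (\<lambda>j. {a j<..<b j})) x)"
    "(\<integral>x. h x * indicator (PiE J (\<lambda>j. {a j<..<b j})) x \<partial>?M) = 0"
    if "\<And>j. j \<in> J \<Longrightarrow> {a j..b j} \<subseteq> interior (\<Omega> j)" for a b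
    using integral_box_eq_0[OF J h z that] by simp_all
  have g: "integrable ?M g" "integral\<^sup>L ?M g = 0" using box[OF cd] by (simp_all add: g_def)
  have sets: "sets ?M = sigma_sets (PiE J \<Omega>) G"
    unfolding G_def by (rule sets_block_generated_by_boxes[OF J])
  have int: "integrable ?M (\<lambda>x. g x * indicator X x)" if "X \<in> sets ?M" for X
    using integrable_mult_indicator[OF that g(1)] by (simp add: mult.commute)
  have zero: "(\<integral>x. g x * indicator X x \<partial>?M) = 0" if "X \<in> sets ?M" for X
  proof -
    have stable: "Int_stable G"
    proof (rule Int_stableI)
      fix A B assume "A \<in> G" "B \<in> G"
      then obtain a b a' b' where AB: "A = PiE J (\<lambda>j. \<Omega> j \<inter> {a j<..<b j})"
        "B = PiE J (\<lambda>j. \<Omega> j \<inter> {a' j<..<b' j})" by (auto simp: G_def)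
      have "A \<inter> B = PiE J (\<lambda>j. \<Omega> j \<inter> {max (a j) (a' j)<..<min (b j) (b' j)})"
        unfolding AB by (auto simp: PiE_iff)
      then show "A \<inter> B \<in> G" unfolding G_def by (intro CollectI exI) auto
    qed
    have sub: "G \<subseteq> Pow (PiE J \<Omega>)" by (auto simp: G_def PiE_iff)
    from that have "X \<in> sigma_sets (PiE J \<Omega>) G" by (simp add: sets)
    with stable sub show ?thesis
    proof (induction rule: sigma_sets_induct_disjoint)
      case (basic A)
      then obtain a b where A: "A = PiE J (\<lambda>j. \<Omega> j \<inter> {a j<..<b j})" by (auto simp: G_def)
      have "(\<integral>x. g x * indicator A x \<partial>?M) =
        (\<integral>x. h x * indicator (PiE J (\<lambda>j. {max (c j) (a j)<..<min (d j) (b j)})) x \<partial>?M)"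
        unfolding A g_def
        by (intro Bochner_Integration.integral_cong refl)
           (auto simp: space_block PiE_iff indicator_def)
      also have "\<dots> = 0"
        using cd by (intro box(2)) fastforce
      finally show ?case .
    next
      case empty show ?case by simp
    next
      case (compl A)
      then have A: "A \<in> sets ?M" by (simp add: sets)
      have "(\<integral>x. g x * indicator (PiE J \<Omega> - A) x \<partial>?M) = (\<integral>x. g x - g x * indicator A x \<partial>?M)"
        by (intro Bochner_Integration.integral_cong refl) (auto simp: space_block indicator_def)
      also have "\<dots> = 0" using g int[OF A] compl by simp
      finally show ?case .
    next
      case (union A)
      then have A: "A i \<in> sets ?M" for i using union(2) by (auto simp: sets)
      have "(LINT x:(\<Union>i. A i)|?M. g x) = (\<Sum>i. (LINT x:(A i)|?M. g x))"
      proof (rule lebesgue_integral_countable_add)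
        show "A i \<inter> A j = {}" if "i \<noteq> j" for i j using union(1) that by (auto simp: disjoint_family_on_def)
        show "set_integrable ?M (\<Union>i. A i) g"
          unfolding set_integrable_def using A by (intro integrable_mult_indicator g) auto
      qed (rule A)
      then show ?case using union(3) by (simp add: set_lebesgue_integral_def mult.commute)
    qed
  qed
  have meas: "g \<in> borel_measurable ?M" using g(1) by (rule borel_measurable_integrable)
  have "AE x in ?M. g x * indicator {x\<in>space ?M. 0 < g x} x = 0"
  proof (subst integral_nonneg_eq_0_iff_AE[symmetric])
    have X: "{x\<in>space ?M. 0 < g x} \<in> sets ?M" using meas by measurable
    show "integrable ?M (\<lambda>x. g x * indicator {x\<in>space ?M. 0 < g x} x)" by (rule int[OF X])
    show "(\<integral>x. g x * indicator {x\<in>space ?M. 0 < g x} x \<partial>?M) = 0" by (rule zero[OF X])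
  qed (auto simp: indicator_def)
  moreover have "AE x in ?M. - (g x * indicator {x\<in>space ?M. g x < 0} x) = 0"
  proof (subst integral_nonneg_eq_0_iff_AE[symmetric])
    have X: "{x\<in>space ?M. g x < 0} \<in> sets ?M" using meas by measurable
    show "integrable ?M (\<lambda>x. - (g x * indicator {x\<in>space ?M. g x < 0} x))" using int[OF X] by simp
    show "(\<integral>x. - (g x * indicator {x\<in>space ?M. g x < 0} x) \<partial>?M) = 0" using zero[OF X] by simp
  qed (auto simp: indicator_def)
  ultimately have "AE x in ?M. g x = 0"
    using AE_space by eventually_elim (auto simp: indicator_def split: if_splits)
  then show ?thesis by eventually_elim (auto simp: g_def)
qed

text \<open>
  Test functions see only the interior of the block, but the frontier of an interval is negligible.
\<close>

lemma AE_interior: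
  assumes J: "good_block \<Omega> J"
  shows "AE x in block_measure \<Omega> J. x \<in> PiE J (\<lambda>j. interior (\<Omega> j))"
proof -
  have "AE x in block_measure \<Omega> J. x j \<in> interior (\<Omega> j)" if j: "j \<in> J" for j
  proof -
    define N where "N = (\<lambda>i. if i = j then \<Omega> j - interior (\<Omega> j) else \<Omega> i)"
    have dom: "one_dim_domain (\<Omega> i)" if "i \<in> J" for i using J that by (simp add: good_block_def)
    then have b: "\<Omega> i \<in> sets borel" if "i \<in> J" for i using that one_dim_domain_borel by blast
    have Nb: "N i \<in> sets borel" "N i \<subseteq> \<Omega> i" if "i \<in> J" for i
      using b[OF that] by (auto simp: N_def)
    have "convex (\<Omega> j)" using dom[OF j] by (simp add: one_dim_domain_def is_interval_connected_1[symmetric] is_interval_convex)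
    then have "negligible (frontier (\<Omega> j))" by (rule negligible_convex_frontier)
    then have "negligible (N j)"
      by (rule negligible_subset) (auto simp: N_def frontier_def intro: closure_subset[THEN subsetD])
    then have "emeasure lborel (N j) = 0"
      using Nb(1)[OF j] by (auto simp: negligible_iff_null_sets null_sets_completion_iff null_sets_def)
    then have "emeasure (block_measure \<Omega> J) (PiE J N) = 0"
      using j good_block_finite[OF J] by (simp add: box_in_sets(2)[OF J Nb] prod_zero_iff) blast
    then have "AE x in block_measure \<Omega> J. x \<notin> PiE J N"
      by (intro AE_not_in) (simp add: null_sets_def box_in_sets(1)[OF J Nb])
    then show ?thesis
      using AE_space by eventually_elim (use j in \<open>auto simp: N_def space_block PiE_iff split: if_splits\<close>)
  qed
  then have "AE x in block_measure \<Omega> J. \<forall>j\<in>J. x j \<in> interior (\<Omega> j)"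
    using good_block_finite[OF J] by (simp add: AE_finite_all)
  then show ?thesis using AE_space by eventually_elim (auto simp: space_block PiE_iff)
qed

text \<open>
  The interior of the block, which has full measure, is covered by the countably many boxes with
  rational corners whose closure lies in it, and \<open>h\<close> vanishes almost everywhere on each of them.
\<close>

lemma fundamental_lemma:
  assumes J: "good_block \<Omega> J" and h: "square_integrable \<Omega> J h"
    and z: "\<And>\<phi>. test_function \<Omega> J \<phi> \<Longrightarrow> (\<integral>x. h x * \<phi> x \<partial>block_measure \<Omega> J) = 0"
  shows "AE x in block_measure \<Omega> J. h x = 0"
proof -
  define C where "C = {p \<in> PiE J (\<lambda>_. \<rat> \<times> \<rat>). \<forall>j\<in>J. {fst (p j)..snd (p j)} \<subseteq> interior (\<Omega> j)}"
  have "countable (PiE J (\<lambda>_. \<rat> \<times> \<rat> :: (real \<times> real) set))"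
    using good_block_finite[OF J] by (intro countable_PiE) (auto simp: countable_rat)
  then have "countable C" unfolding C_def by (rule countable_subset[rotated]) auto
  then have "AE x in block_measure \<Omega> J. \<forall>p\<in>C. x \<in> PiE J (\<lambda>j. {fst (p j)<..<snd (p j)}) \<longrightarrow> h x = 0"
    by (subst AE_ball_countable) (auto simp: C_def intro!: AE_0_on_box[OF J h z])
  then show ?thesis using AE_interior[OF J]
  proof eventually_elim
    case (elim x)
    have "\<exists>p. p \<in> \<rat> \<times> \<rat> \<and> {fst p..snd p} \<subseteq> interior (\<Omega> j) \<and> x j \<in> {fst p<..<snd p}" if j: "j \<in> J" for j
    proof -
      have "x j \<in> interior (\<Omega> j)" using elim(2) j by (simp add: PiE_iff)
      then obtain e where e: "e > 0" "cball (x j) e \<subseteq> interior (\<Omega> j)"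
        using open_contains_cball open_interior by blast
      obtain p q where "p \<in> \<rat>" "q \<in> \<rat>" "x j - e < p" "p < x j" "x j < q" "q < x j + e"
        using Rats_dense_in_real[of "x j - e" "x j"] Rats_dense_in_real[of "x j" "x j + e"] e(1) by auto
      then show ?thesis by (intro exI[of _ "(p, q)"]) (auto simp: cball_def dist_real_def intro!: subsetD[OF e(2)])
    qed
    then obtain p where p: "\<And>j. j \<in> J \<Longrightarrow> p j \<in> \<rat> \<times> \<rat> \<and> {fst (p j)..snd (p j)} \<subseteq> interior (\<Omega> j) \<and>
        x j \<in> {fst (p j)<..<snd (p j)}" by metis
    then have "restrict p J \<in> C" "x \<in> PiE J (\<lambda>j. {fst (restrict p J j)<..<snd (restrict p J j)})"
      using elim(2) by (auto simp: C_def PiE_iff)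
    then show ?case using elim(1) by blast
  qed
qed

section \<open>Weak derivatives\<close>

lemma weak_deriv_unique:
  assumes J: "good_block \<Omega> J"
    and g: "square_integrable \<Omega> J g" "is_weak_deriv \<Omega> J \<alpha> f g"
    and h: "square_integrable \<Omega> J h" "is_weak_deriv \<Omega> J \<alpha> f h"
  shows "AE x in block_measure \<Omega> J. g x = h x"
proof -
  have "square_integrable \<Omega> J (\<lambda>x. g x + (-1) * h x)"
    by (intro square_integrable_add square_integrable_scale g h)
  then have "AE x in block_measure \<Omega> J. g x + (-1) * h x = 0"
  proof (rule fundamental_lemma[OF J])
    fix \<phi> assume t: "test_function \<Omega> J \<phi>"
    note \<phi> = test_function_square_integrable[OF J t]
    have "(-1) ^ (\<Sum>j\<in>J. \<alpha> j) * (\<integral>x. g x * \<phi> x \<partial>block_measure \<Omega> J) =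
       (-1) ^ (\<Sum>j\<in>J. \<alpha> j) * (\<integral>x. h x * \<phi> x \<partial>block_measure \<Omega> J)"
      using g(2) h(2) t unfolding is_weak_deriv_def by metis
    then have "(\<integral>x. g x * \<phi> x \<partial>block_measure \<Omega> J) = (\<integral>x. h x * \<phi> x \<partial>block_measure \<Omega> J)" by simp
    moreover have "(\<integral>x. (g x + (-1) * h x) * \<phi> x \<partial>block_measure \<Omega> J) =
      (\<integral>x. g x * \<phi> x - h x * \<phi> x \<partial>block_measure \<Omega> J)" by (simp add: algebra_simps)
    ultimately show "(\<integral>x. (g x + (-1) * h x) * \<phi> x \<partial>block_measure \<Omega> J) = 0"
      using square_integrable_mult[OF g(1) \<phi>] square_integrable_mult[OF h(1) \<phi>] by simp
  qed
  then show ?thesis by eventually_elim simp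
qed

text \<open>
  This is how the arbitrary choice in \<open>weak_deriv\<close> is controlled: any square integrable weak
  derivative that can be exhibited is the chosen one, up to a null set.
\<close>

lemma weak_deriv_eq:
  assumes J: "good_block \<Omega> J" and g: "square_integrable \<Omega> J g" "is_weak_deriv \<Omega> J \<alpha> f g"
  shows "AE x in block_measure \<Omega> J. weak_deriv \<Omega> J \<alpha> f x = g x"
proof -
  have "square_integrable \<Omega> J (weak_deriv \<Omega> J \<alpha> f) \<and> is_weak_deriv \<Omega> J \<alpha> f (weak_deriv \<Omega> J \<alpha> f)"
    unfolding weak_deriv_def by (rule someI[of _ g]) (simp add: g)
  then show ?thesis using weak_deriv_unique[OF J _ _ g] by blast
qed

lemma sobolev_spaceD:
  assumes "f \<in> sobolev_space A \<Omega> J"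
  shows "square_integrable \<Omega> J f"
    and "\<alpha> \<in> A \<Longrightarrow> square_integrable \<Omega> J (weak_deriv \<Omega> J \<alpha> f)"
    and "\<alpha> \<in> A \<Longrightarrow> is_weak_deriv \<Omega> J \<alpha> f (weak_deriv \<Omega> J \<alpha> f)"
proof -
  show "square_integrable \<Omega> J f" using assms by (simp add: sobolev_space_def)
  assume "\<alpha> \<in> A"
  then have "\<exists>g. square_integrable \<Omega> J g \<and> is_weak_deriv \<Omega> J \<alpha> f g"
    using assms by (simp add: sobolev_space_def)
  then have "square_integrable \<Omega> J (weak_deriv \<Omega> J \<alpha> f) \<and> is_weak_deriv \<Omega> J \<alpha> f (weak_deriv \<Omega> J \<alpha> f)"
    unfolding weak_deriv_def by (rule someI_ex)
  then show "square_integrable \<Omega> J (weak_deriv \<Omega> J \<alpha> f)"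
    "is_weak_deriv \<Omega> J \<alpha> f (weak_deriv \<Omega> J \<alpha> f)" by blast+
qed

lemma test_function_deriv_square_integrable:
  assumes J: "good_block \<Omega> J" and t: "test_function \<Omega> J \<phi>"
  shows "square_integrable \<Omega> J (classical_deriv J \<alpha> \<phi>)"
  using test_function_classical_deriv[of \<Omega> J J \<phi> \<alpha>] t good_block_finite[OF J]
  by (intro test_function_square_integrable[OF J]) simp

lemma is_weak_deriv_add:
  assumes J: "good_block \<Omega> J"
    and L2: "square_integrable \<Omega> J f" "square_integrable \<Omega> J f'"
      "square_integrable \<Omega> J g" "square_integrable \<Omega> J g'"
    and w: "is_weak_deriv \<Omega> J \<alpha> f f'" "is_weak_deriv \<Omega> J \<alpha> g g'"
  shows "is_weak_deriv \<Omega> J \<alpha> (\<lambda>x. f x + g x) (\<lambda>x. f' x + g' x)"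
  unfolding is_weak_deriv_def
proof (intro allI impI)
  fix \<phi> assume t: "test_function \<Omega> J \<phi>"
  note \<phi> = test_function_square_integrable[OF J t]
  note D\<phi> = test_function_deriv_square_integrable[OF J t, of \<alpha>]
  show "(\<integral>x. (f x + g x) * classical_deriv J \<alpha> \<phi> x \<partial>block_measure \<Omega> J) =
     (-1) ^ (\<Sum>j\<in>J. \<alpha> j) * (\<integral>x. (f' x + g' x) * \<phi> x \<partial>block_measure \<Omega> J)"
    using w t square_integrable_mult[OF L2(1) D\<phi>] square_integrable_mult[OF L2(3) D\<phi>]
      square_integrable_mult[OF L2(2) \<phi>] square_integrable_mult[OF L2(4) \<phi>]
    unfolding is_weak_deriv_def by (simp add: distrib_right distrib_left)
qed

lemma is_weak_deriv_scale:
  "is_weak_deriv \<Omega> J \<alpha> f f' \<Longrightarrow> is_weak_deriv \<Omega> J \<alpha> (\<lambda>x. c * f x) (\<lambda>x. c * f' x)"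
  unfolding is_weak_deriv_def by (simp add: mult.assoc mult.left_commute)

section \<open>Sobolev spaces as semi-inner product spaces\<close>

text \<open>
  Functions that agree almost everywhere are not identified, so the Sobolev inner product is only
  positive semi-definite.
\<close>

locale semi_inner_space =
  fixes V :: "('a \<Rightarrow> real) set" and B :: "('a \<Rightarrow> real) \<Rightarrow> ('a \<Rightarrow> real) \<Rightarrow> real"
  assumes zero_mem: "(\<lambda>x. 0) \<in> V"
    and add_mem: "f \<in> V \<Longrightarrow> g \<in> V \<Longrightarrow> (\<lambda>x. f x + g x) \<in> V"
    and scale_mem: "f \<in> V \<Longrightarrow> (\<lambda>x. c * f x) \<in> V"
    and sym: "B f g = B g f"
    and add_left: "f \<in> V \<Longrightarrow> g \<in> V \<Longrightarrow> h \<in> V \<Longrightarrow> B (\<lambda>x. f x + g x) h = B f h + B g h"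
    and scale_left: "f \<in> V \<Longrightarrow> h \<in> V \<Longrightarrow> B (\<lambda>x. c * f x) h = c * B f h"
    and nonneg: "0 \<le> B f f"
begin

lemma sum_mem: "(\<And>i. i \<in> S \<Longrightarrow> f i \<in> V) \<Longrightarrow> (\<lambda>x. \<Sum>i\<in>S. f i x) \<in> V"
  by (induction S rule: infinite_finite_induct) (auto intro: zero_mem add_mem)

lemma diff_mem: "f \<in> V \<Longrightarrow> g \<in> V \<Longrightarrow> (\<lambda>x. f x - g x) \<in> V"
  using add_mem[OF _ scale_mem[of g "-1"], of f] by simp

lemma zero_left: "h \<in> V \<Longrightarrow> B (\<lambda>x. 0) h = 0"
  using scale_left[OF zero_mem, of h 0] by simp

lemma sum_left:
  "(\<And>i. i \<in> S \<Longrightarrow> f i \<in> V) \<Longrightarrow> h \<in> V \<Longrightarrow> B (\<lambda>x. \<Sum>i\<in>S. f i x) h = (\<Sum>i\<in>S. B (f i) h)"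
  by (induction S rule: infinite_finite_induct) (auto simp: zero_left add_left sum_mem)

lemma add_square:
  assumes "f \<in> V" "g \<in> V"
  shows "B (\<lambda>x. f x + c * g x) (\<lambda>x. f x + c * g x) = B f f + 2 * c * B f g + c\<^sup>2 * B g g"
proof -
  have "B (\<lambda>x. f x + c * g x) h = B f h + c * B g h" if "h \<in> V" for h
    using assms that by (simp add: add_left scale_left scale_mem)
  then have "B (\<lambda>x. f x + c * g x) (\<lambda>x. f x + c * g x) =
      B (\<lambda>x. f x + c * g x) f + c * B (\<lambda>x. f x + c * g x) g"
    using assms by (metis sym add_mem scale_mem)
  also have "\<dots> = B f f + c * B g f + c * (B f g + c * B g g)"
    using assms by (simp add: add_left scale_left scale_mem)
  finally show ?thesis using sym[of g f] by (simp add: algebra_simps power2_eq_square)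
qed

lemma Cauchy_Schwarz:
  assumes "f \<in> V" "g \<in> V"
  shows "\<bar>B f g\<bar> \<le> sqrt (B f f) * sqrt (B g g)"
proof -
  have *: "0 \<le> B f f + 2 * c * B f g + c\<^sup>2 * B g g" for c
    using add_square[OF assms, of c] nonneg by metis
  have "(B f g)\<^sup>2 \<le> B f f * B g g"
  proof (cases "B g g = 0")
    case True
    have "B f g = 0"
    proof (rule ccontr)
      assume "B f g \<noteq> 0"
      \<comment> \<open>this \<open>c\<close> makes the quadratic polynomial equal to \<open>-1\<close>\<close>
      then have "2 * (- (B f f + 1) / (2 * B f g)) * B f g = - (B f f + 1)" by simp
      then show False using *[of "- (B f f + 1) / (2 * B f g)"] True by simp
    qed
    then show ?thesis by (simp add: nonneg)
  next
    case False
    then have pos: "B g g > 0" using nonneg[of g] by simp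
    \<comment> \<open>\<open>c = - B f g / B g g\<close> minimises the quadratic polynomial\<close>
    have "0 \<le> B f f - (B f g)\<^sup>2 / B g g"
      using *[of "- B f g / B g g"] pos by (simp add: power2_eq_square field_simps)
    then show ?thesis using pos by (simp add: field_simps)
  qed
  then have "sqrt ((B f g)\<^sup>2) \<le> sqrt (B f f * B g g)" by (rule real_sqrt_le_mono)
  then show ?thesis by (simp add: real_sqrt_mult)
qed

lemma triangle:
  assumes "f \<in> V" "g \<in> V"
  shows "sqrt (B (\<lambda>x. f x + g x) (\<lambda>x. f x + g x)) \<le> sqrt (B f f) + sqrt (B g g)"
proof (rule real_le_lsqrt)
  have "B f g \<le> sqrt (B f f) * sqrt (B g g)" using Cauchy_Schwarz[OF assms] by simp
  then show "B (\<lambda>x. f x + g x) (\<lambda>x. f x + g x) \<le> (sqrt (B f f) + sqrt (B g g))\<^sup>2"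
    using add_square[OF assms, of 1] by (simp add: power2_sum nonneg)
qed (simp add: nonneg)

lemma reverse_triangle:
  assumes f: "f \<in> V" and g: "g \<in> V"
  shows "\<bar>sqrt (B f f) - sqrt (B g g)\<bar> \<le> sqrt (B (\<lambda>x. f x - g x) (\<lambda>x. f x - g x))"
proof -
  note d = diff_mem[OF f g]
  have "sqrt (B f f) \<le> sqrt (B (\<lambda>x. f x - g x) (\<lambda>x. f x - g x)) + sqrt (B g g)"
    using triangle[OF d g] by simp
  moreover have "sqrt (B g g) \<le> sqrt (B f f) + sqrt (B (\<lambda>x. f x - g x) (\<lambda>x. f x - g x))"
    using triangle[OF f scale_mem[OF d, of "-1"]] scale_left[OF d scale_mem[OF d, of "-1"], of "-1"]
      scale_left[OF d d, of "-1"] sym[of "\<lambda>x. f x - g x" "\<lambda>x. - 1 * (f x - g x)"]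
    by simp
  ultimately show ?thesis by linarith
qed

lemma orthogonal_sum:
  assumes "finite S" "\<And>i. i \<in> S \<Longrightarrow> z i \<in> V"
    and "\<And>i l. i \<in> S \<Longrightarrow> l \<in> S \<Longrightarrow> B (z i) (z l) = (if i = l then q i else 0)"
  shows "B (\<lambda>x. \<Sum>i\<in>S. c i * z i x) (\<lambda>x. \<Sum>i\<in>S. c i * z i x) = (\<Sum>i\<in>S. (c i)\<^sup>2 * q i)"
proof -
  let ?s = "\<lambda>x. \<Sum>i\<in>S. c i * z i x"
  have s: "?s \<in> V" using assms(2) by (intro sum_mem scale_mem)
  have "B ?s ?s = (\<Sum>i\<in>S. c i * B (z i) ?s)"
    using assms(2) s by (simp add: sum_left scale_mem scale_left)
  also have "\<dots> = (\<Sum>i\<in>S. c i * (c i * q i))"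
  proof (intro sum.cong refl arg_cong2[where f = "(*)"])
    fix i assume i: "i \<in> S"
    have "B (z i) ?s = B ?s (z i)" by (rule sym)
    also have "\<dots> = (\<Sum>l\<in>S. c l * B (z l) (z i))"
      using assms(2) i by (simp add: sum_left scale_mem scale_left)
    also have "\<dots> = (\<Sum>l\<in>S. if l = i then c i * q i else 0)"
      using assms(3) i by (intro sum.cong) auto
    finally show "B (z i) ?s = c i * q i" using i assms(1) by simp
  qed
  finally show ?thesis by (simp add: power2_eq_square mult.assoc)
qed

text \<open>
  The algebraic core of the error formula. In the expansion of \<open>v\<close> in the orthonormal system \<open>w\<close>, the
  first \<open>r\<close> vectors \<open>w i\<close> are replaced by \<open>D i\<close>, and the new system \<open>z\<close> is still orthogonal. For
  \<open>n \<ge> r\<close> the vector \<open>y\<close> differs from the \<open>n\<close>-th partial sum in the new system exactly by the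
  remainder of \<open>v\<close> in the old one, whose norm tends to \<open>0\<close>. So the norms of those partial sums,
  which Pythagoras gives, converge to the norm of \<open>y\<close>.

  With \<open>w i - D i\<close> the approximation of \<open>w i\<close>, the vector \<open>y\<close> is the total error: its square is the
  discarded tail plus the weighted errors \<open>e i\<close> in the retained terms.
\<close>

lemma perturbed_orthonormal_series:
  assumes v: "v \<in> V"
    and w: "\<And>i. 1 \<le> i \<Longrightarrow> w i \<in> V"
      "\<And>i l. 1 \<le> i \<Longrightarrow> 1 \<le> l \<Longrightarrow> B (w i) (w l) = (if i = l then 1 else 0)"
    and lim: "(\<lambda>n. sqrt (B (\<lambda>x. v x - (\<Sum>i=1..n. c i * w i x)) (\<lambda>x. v x - (\<Sum>i=1..n. c i * w i x)))) \<longlonglongrightarrow> 0"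
    and D: "\<And>i. 1 \<le> i \<Longrightarrow> i \<le> r \<Longrightarrow> D i \<in> V"
      "\<And>i l. 1 \<le> i \<Longrightarrow> i \<le> r \<Longrightarrow> 1 \<le> l \<Longrightarrow> l \<le> r \<Longrightarrow> B (D i) (D l) = (if i = l then e i else 0)"
      "\<And>i l. 1 \<le> i \<Longrightarrow> i \<le> r \<Longrightarrow> r < l \<Longrightarrow> B (D i) (w l) = 0"
  defines "y \<equiv> (\<lambda>x. v x - (\<Sum>i=1..r. c i * (w i x - D i x)))"
  shows "(\<lambda>i. (c i)\<^sup>2) summable_on {r<..}"
    and "B y y = (\<Sum>\<^sub>\<infinity>i\<in>{r<..}. (c i)\<^sup>2) + (\<Sum>i=1..r. (c i)\<^sup>2 * e i)"
proof -
  define z where "z = (\<lambda>i. if i \<le> r then D i else w i)"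
  define q where "q = (\<lambda>i. if i \<le> r then e i else 1)"
  define b where "b = (\<lambda>n x. \<Sum>i=1..n. c i * z i x)"
  have z: "z i \<in> V" if "1 \<le> i" for i using that w(1) D(1) by (simp add: z_def)
  have zz: "B (z i) (z l) = (if i = l then q i else 0)" if "1 \<le> i" "1 \<le> l" for i l
    using that w(2)[of i l] D(2)[of i l] D(3)[of i l] D(3)[of l i] sym[of "w i" "D l"]
    by (auto simp: z_def q_def)
  have bV: "b n \<in> V" for n unfolding b_def by (intro sum_mem scale_mem z) simp
  have yV: "y \<in> V" unfolding y_def
    by (intro diff_mem v sum_mem scale_mem w D) auto
  have bb: "B (b n) (b n) = (\<Sum>i=1..n. (c i)\<^sup>2 * q i)" for n
    unfolding b_def by (intro orthogonal_sum z zz) auto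
  have yb: "(\<lambda>x. y x - b n x) = (\<lambda>x. v x - (\<Sum>i=1..n. c i * w i x))" if n: "r \<le> n" for n
  proof
    fix x
    have split: "(\<Sum>i=1..n. g i) = (\<Sum>i=1..r. g i) + (\<Sum>i=r+1..n. g i)" for g :: "nat \<Rightarrow> real"
    proof -
      have "{1..n} = {1..r} \<union> {r+1..n}" using n by auto
      then show ?thesis by (simp add: sum.union_disjoint)
    qed
    have "(\<Sum>i=r+1..n. c i * z i x) = (\<Sum>i=r+1..n. c i * w i x)" "(\<Sum>i=1..r. c i * z i x) = (\<Sum>i=1..r. c i * D i x)"
      by (auto simp: z_def intro!: sum.cong)
    then show "y x - b n x = v x - (\<Sum>i=1..n. c i * w i x)"
      unfolding y_def b_def split by (simp add: right_diff_distrib sum_subtractf)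
  qed
  have "(\<lambda>n. sqrt (B (b n) (b n))) \<longlonglongrightarrow> sqrt (B y y)"
  proof (rule LIM_zero_cancel, rule Lim_null_comparison[OF _ lim])
    have "norm (sqrt (B (b n) (b n)) - sqrt (B y y)) \<le>
        sqrt (B (\<lambda>x. v x - (\<Sum>i=1..n. c i * w i x)) (\<lambda>x. v x - (\<Sum>i=1..n. c i * w i x)))"
      if "r \<le> n" for n
      using reverse_triangle[OF yV bV, of n] unfolding yb[OF that] by (simp add: abs_minus_commute)
    then show "eventually (\<lambda>n. norm (sqrt (B (b n) (b n)) - sqrt (B y y)) \<le>
        sqrt (B (\<lambda>x. v x - (\<Sum>i=1..n. c i * w i x)) (\<lambda>x. v x - (\<Sum>i=1..n. c i * w i x)))) sequentially"
      by (rule eventually_sequentiallyI)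
  qed
  then have "(\<lambda>n. (sqrt (B (b n) (b n)))\<^sup>2) \<longlonglongrightarrow> (sqrt (B y y))\<^sup>2" by (rule tendsto_power)
  then have partial: "(\<lambda>n. \<Sum>i=1..n. (c i)\<^sup>2 * q i) \<longlonglongrightarrow> B y y"
    by (simp only: real_sqrt_pow2[OF nonneg] bb[symmetric])
  define F where "F = (\<lambda>i::nat. if i = 0 then 0 else (c i)\<^sup>2 * q i)"
  have "sum F {..n} = (\<Sum>i=1..n. (c i)\<^sup>2 * q i)" for n
  proof -
    have "{..n} = insert 0 {1..n}" by auto
    then show ?thesis by (simp add: F_def)
  qed
  then have F: "F sums B y y" using partial by (simp add: sums_def_le)
  have q0: "0 \<le> q i" if "1 \<le> i" for i
    using that zz[of i i] nonneg[of "z i"] by simp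
  then have "norm (F i) = F i" for i by (simp add: F_def)
  then have "(F has_sum B y y) UNIV"
    using F by (intro norm_summable_imp_has_sum) (auto simp: sums_iff)
  then have hs: "((\<lambda>i. (c i)\<^sup>2 * q i) has_sum B y y) {1..}"
    by (rule has_sum_cong_neutral[THEN iffD1, rotated -1]) (auto simp: F_def)
  have "(\<lambda>i. (c i)\<^sup>2 * q i) summable_on {r<..}"
    using hs by (intro summable_on_subset_banach[OF has_sum_imp_summable]) auto
  then show sm: "(\<lambda>i. (c i)\<^sup>2) summable_on {r<..}"
    by (rule summable_on_cong[THEN iffD1, rotated]) (simp add: q_def)
  have hs2: "((\<lambda>i. (c i)\<^sup>2 * q i) has_sum (\<Sum>\<^sub>\<infinity>i\<in>{r<..}. (c i)\<^sup>2)) {r<..}"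
    by (rule has_sum_cong[THEN iffD1, OF _ has_sum_infsum[OF sm]]) (simp add: q_def)
  have hs1: "((\<lambda>i. (c i)\<^sup>2 * q i) has_sum (\<Sum>i=1..r. (c i)\<^sup>2 * e i)) {1..r}"
    by (rule has_sum_finiteI) (auto simp: q_def)
  have "{1..r} \<union> {r<..} = {1..}" "{1..r} \<inter> {r<..} = {}" by auto
  then have hs12: "((\<lambda>i. (c i)\<^sup>2 * q i) has_sum ((\<Sum>i=1..r. (c i)\<^sup>2 * e i) + (\<Sum>\<^sub>\<infinity>i\<in>{r<..}. (c i)\<^sup>2))) {1..}"
    using has_sum_Un_disjoint[OF hs1 hs2] by simp
  show "B y y = (\<Sum>\<^sub>\<infinity>i\<in>{r<..}. (c i)\<^sup>2) + (\<Sum>i=1..r. (c i)\<^sup>2 * e i)"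
    using has_sum_unique[OF hs hs12] by simp
qed

end

text \<open>
  Linearity of the inner product rests on the uniqueness of weak derivatives: \<open>weak_deriv\<close> itself
  is linear only almost everywhere.
\<close>

lemma sobolev_semi_inner_space:
  assumes J: "good_block \<Omega> J"
  shows "semi_inner_space (sobolev_space A \<Omega> J) (sobolev_inner A \<Omega> J)"
proof
  let ?V = "sobolev_space A \<Omega> J" and ?B = "sobolev_inner A \<Omega> J" and ?M = "block_measure \<Omega> J"
  show "(\<lambda>x. 0) \<in> ?V"
    by (auto simp: sobolev_space_def square_integrable_def is_weak_deriv_def intro!: exI[of _ "\<lambda>x. 0"])
  show sum: "(\<lambda>x. f x + g x) \<in> ?V" if "f \<in> ?V" "g \<in> ?V" for f g
  proof -
    note D = sobolev_spaceD[OF that(1)] sobolev_spaceD[OF that(2)]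
    show ?thesis unfolding sobolev_space_def
    proof (intro CollectI conjI ballI exI)
      show "square_integrable \<Omega> J (\<lambda>x. f x + g x)" by (intro square_integrable_add D)
      fix \<alpha> assume "\<alpha> \<in> A"
      then show "square_integrable \<Omega> J (\<lambda>x. weak_deriv \<Omega> J \<alpha> f x + weak_deriv \<Omega> J \<alpha> g x)"
        "is_weak_deriv \<Omega> J \<alpha> (\<lambda>x. f x + g x) (\<lambda>x. weak_deriv \<Omega> J \<alpha> f x + weak_deriv \<Omega> J \<alpha> g x)"
        by (intro square_integrable_add is_weak_deriv_add J D; assumption)+
    qed
  qed
  show scale: "(\<lambda>x. c * f x) \<in> ?V" if "f \<in> ?V" for c f
  proof -
    note D = sobolev_spaceD[OF that]
    show ?thesis unfolding sobolev_space_def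
    proof (intro CollectI conjI ballI exI)
      show "square_integrable \<Omega> J (\<lambda>x. c * f x)" by (intro square_integrable_scale D)
      fix \<alpha> assume "\<alpha> \<in> A"
      then show "square_integrable \<Omega> J (\<lambda>x. c * weak_deriv \<Omega> J \<alpha> f x)"
        "is_weak_deriv \<Omega> J \<alpha> (\<lambda>x. c * f x) (\<lambda>x. c * weak_deriv \<Omega> J \<alpha> f x)"
        by (intro square_integrable_scale is_weak_deriv_scale D; assumption)+
    qed
  qed
  show "?B f g = ?B g f" for f g by (simp add: sobolev_inner_def mult.commute)
  show "0 \<le> ?B f f" for f unfolding sobolev_inner_def by (intro sum_nonneg integral_nonneg_AE) simp
  show "?B (\<lambda>x. f x + g x) h = ?B f h + ?B g h" if "f \<in> ?V" "g \<in> ?V" "h \<in> ?V" for f g h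
    unfolding sobolev_inner_def sum.distrib[symmetric]
  proof (intro sum.cong refl)
    fix \<alpha> assume \<alpha>: "\<alpha> \<in> A"
    note f = sobolev_spaceD[OF that(1)] note g = sobolev_spaceD[OF that(2)]
    note h = sobolev_spaceD[OF that(3)] note s = sobolev_spaceD[OF sum[OF that(1,2)]]
    note f' = f(2)[OF \<alpha>] note g' = g(2)[OF \<alpha>] note h' = h(2)[OF \<alpha>]
    have "AE x in ?M. weak_deriv \<Omega> J \<alpha> (\<lambda>x. f x + g x) x = weak_deriv \<Omega> J \<alpha> f x + weak_deriv \<Omega> J \<alpha> g x"
      by (intro weak_deriv_eq J square_integrable_add is_weak_deriv_add f(1) g(1) f' g' f(3)[OF \<alpha>] g(3)[OF \<alpha>])
    then have "(\<integral>x. weak_deriv \<Omega> J \<alpha> (\<lambda>x. f x + g x) x * weak_deriv \<Omega> J \<alpha> h x \<partial>?M) =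
      (\<integral>x. weak_deriv \<Omega> J \<alpha> f x * weak_deriv \<Omega> J \<alpha> h x + weak_deriv \<Omega> J \<alpha> g x * weak_deriv \<Omega> J \<alpha> h x \<partial>?M)"
      using square_integrable_mult[OF s(2)[OF \<alpha>] h'] square_integrable_mult[OF f' h'] square_integrable_mult[OF g' h']
      by (intro integral_cong_AE) (auto simp: distrib_right)
    then show "(\<integral>x. weak_deriv \<Omega> J \<alpha> (\<lambda>x. f x + g x) x * weak_deriv \<Omega> J \<alpha> h x \<partial>?M) =
      (\<integral>x. weak_deriv \<Omega> J \<alpha> f x * weak_deriv \<Omega> J \<alpha> h x \<partial>?M) + (\<integral>x. weak_deriv \<Omega> J \<alpha> g x * weak_deriv \<Omega> J \<alpha> h x \<partial>?M)"
      using square_integrable_mult[OF f' h'] square_integrable_mult[OF g' h'] by simp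
  qed
  show "?B (\<lambda>x. c * f x) h = c * ?B f h" if "f \<in> ?V" "h \<in> ?V" for c f h
    unfolding sobolev_inner_def sum_distrib_left
  proof (intro sum.cong refl)
    fix \<alpha> assume \<alpha>: "\<alpha> \<in> A"
    note f = sobolev_spaceD[OF that(1)] note h = sobolev_spaceD[OF that(2)]
    note s = sobolev_spaceD[OF scale[OF that(1)]]
    note f' = f(2)[OF \<alpha>] note h' = h(2)[OF \<alpha>]
    have "AE x in ?M. weak_deriv \<Omega> J \<alpha> (\<lambda>x. c * f x) x = c * weak_deriv \<Omega> J \<alpha> f x"
      by (intro weak_deriv_eq J square_integrable_scale is_weak_deriv_scale f' f(3)[OF \<alpha>])
    then have "(\<integral>x. weak_deriv \<Omega> J \<alpha> (\<lambda>x. c * f x) x * weak_deriv \<Omega> J \<alpha> h x \<partial>?M) =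
      (\<integral>x. c * (weak_deriv \<Omega> J \<alpha> f x * weak_deriv \<Omega> J \<alpha> h x) \<partial>?M)"
      using square_integrable_mult[OF s(2)[OF \<alpha>] h'] square_integrable_mult[OF f' h']
      by (intro integral_cong_AE) auto
    then show "(\<integral>x. weak_deriv \<Omega> J \<alpha> (\<lambda>x. c * f x) x * weak_deriv \<Omega> J \<alpha> h x \<partial>?M) =
      c * (\<integral>x. weak_deriv \<Omega> J \<alpha> f x * weak_deriv \<Omega> J \<alpha> h x \<partial>?M)" by simp
  qed
qed

section \<open>Sobolev spaces of tensor products\<close>

lemma tensor_fun_commute: "tensor_fun I J f g = tensor_fun J I g f"
  by (simp add: tensor_fun_def mult.commute)

lemma classical_deriv_cong:
  "finite J \<Longrightarrow> (\<And>j. j \<in> J \<Longrightarrow> \<alpha> j = \<beta> j) \<Longrightarrow> classical_deriv J \<alpha> f = classical_deriv J \<beta> f"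
  unfolding classical_deriv_def by (intro fold_cong) auto

lemma is_weak_deriv_cong:
  "finite J \<Longrightarrow> (\<And>j. j \<in> J \<Longrightarrow> \<alpha> j = \<beta> j) \<Longrightarrow> is_weak_deriv \<Omega> J \<alpha> f g \<longleftrightarrow> is_weak_deriv \<Omega> J \<beta> f g"
  unfolding is_weak_deriv_def by (simp add: classical_deriv_cong[of J \<alpha> \<beta>] cong: sum.cong)

text \<open>
  The derivatives are taken in increasing order of the variables, so when \<open>I\<close> precedes \<open>J\<close> no
  interchange of partial derivatives is involved.
\<close>

lemma classical_deriv_union:
  assumes "finite I" "finite J" "\<forall>i\<in>I. \<forall>j\<in>J. i < j"
  shows "classical_deriv (I \<union> J) \<alpha> f = classical_deriv J \<alpha> (classical_deriv I \<alpha> f)"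
proof -
  have "I \<inter> J = {}" using assms(3) by fastforce
  then have "sorted_list_of_set (I \<union> J) = sorted_list_of_set I @ sorted_list_of_set J"
    using assms by (intro sorted_distinct_set_unique) (auto simp: sorted_append less_imp_le)
  then show ?thesis by (simp add: classical_deriv_def)
qed

text \<open>
  By Fubini's theorem, for each frozen \<open>x\<close> in the first block this is the definition of the weak
  derivative of \<open>g\<close>, tested against the slice of \<open>\<Phi>\<close> at \<open>x\<close>.
\<close>

lemma weak_deriv_second_factor:
  assumes I: "good_block \<Omega> I" and J: "good_block \<Omega> J" and IJ: "I \<inter> J = {}"
    and f: "square_integrable \<Omega> I f"
    and g: "square_integrable \<Omega> J g" "square_integrable \<Omega> J g'" "is_weak_deriv \<Omega> J \<alpha> g g'"
    and t: "test_function \<Omega> (I \<union> J) \<Phi>"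
  shows "(\<integral>z. tensor_fun I J f g z * classical_deriv J \<alpha> \<Phi> z \<partial>block_measure \<Omega> (I \<union> J)) =
    (-1) ^ (\<Sum>j\<in>J. \<alpha> j) * (\<integral>z. tensor_fun I J f g' z * \<Phi> z \<partial>block_measure \<Omega> (I \<union> J))"
proof -
  let ?s = "(-1) ^ (\<Sum>j\<in>J. \<alpha> j) :: real"
  note IJ' = good_block_union[OF I J]
  have tD: "test_function \<Omega> (I \<union> J) (classical_deriv J \<alpha> \<Phi>)"
    using test_function_classical_deriv[of \<Omega> J I] t good_block_finite[OF J] by (simp add: Un_commute)
  have int: "integrable (block_measure \<Omega> (I \<union> J)) (\<lambda>z. tensor_fun I J f h z * \<Psi> z)"
    if "square_integrable \<Omega> J h" "test_function \<Omega> (I \<union> J) \<Psi>" for h \<Psi>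
    by (rule square_integrable_mult[OF square_integrable_tensor[OF I J IJ f that(1)]
          test_function_square_integrable[OF IJ' that(2)]])
  have "(\<integral>z. tensor_fun I J f g z * classical_deriv J \<alpha> \<Phi> z \<partial>block_measure \<Omega> (I \<union> J)) =
    (\<integral>x. \<integral>y. tensor_fun I J f g (merge I J (x, y)) * classical_deriv J \<alpha> \<Phi> (merge I J (x, y))
      \<partial>block_measure \<Omega> J \<partial>block_measure \<Omega> I)"
    by (rule integral_block_union(1)[OF I J IJ int[OF g(1) tD]])
  also have "\<dots> = (\<integral>x. ?s * (\<integral>y. tensor_fun I J f g' (merge I J (x, y)) * \<Phi> (merge I J (x, y))
      \<partial>block_measure \<Omega> J) \<partial>block_measure \<Omega> I)"
  proof (intro Bochner_Integration.integral_cong refl)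
    fix x assume x: "x \<in> space (block_measure \<Omega> I)"
    let ?\<phi> = "\<lambda>y. \<Phi> (merge I J (x, y))"
    have "x \<in> PiE I (\<lambda>_. UNIV)" using x by (auto simp: space_block PiE_iff)
    then have \<phi>: "test_function \<Omega> J ?\<phi>" by (rule test_function_slice[OF IJ _ t])
    have "(\<integral>y. tensor_fun I J f g (merge I J (x, y)) * classical_deriv J \<alpha> \<Phi> (merge I J (x, y)) \<partial>block_measure \<Omega> J) =
      (\<integral>y. f x * (g y * classical_deriv J \<alpha> ?\<phi> y) \<partial>block_measure \<Omega> J)"
      unfolding classical_deriv_slice[OF IJ good_block_finite[OF J]]
      using x by (intro Bochner_Integration.integral_cong refl) (simp add: space_block tensor_fun_merge[OF IJ])
    also have "\<dots> = f x * (?s * (\<integral>y. g' y * ?\<phi> y \<partial>block_measure \<Omega> J))"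
      using g(3) \<phi> by (simp add: is_weak_deriv_def)
    also have "\<dots> = ?s * (\<integral>y. f x * (g' y * ?\<phi> y) \<partial>block_measure \<Omega> J)" by simp
    also have "(\<integral>y. f x * (g' y * ?\<phi> y) \<partial>block_measure \<Omega> J) =
       (\<integral>y. tensor_fun I J f g' (merge I J (x, y)) * \<Phi> (merge I J (x, y)) \<partial>block_measure \<Omega> J)"
      using x by (intro Bochner_Integration.integral_cong refl) (simp add: space_block tensor_fun_merge[OF IJ])
    finally show "(\<integral>y. tensor_fun I J f g (merge I J (x, y)) * classical_deriv J \<alpha> \<Phi> (merge I J (x, y)) \<partial>block_measure \<Omega> J) =
      ?s * (\<integral>y. tensor_fun I J f g' (merge I J (x, y)) * \<Phi> (merge I J (x, y)) \<partial>block_measure \<Omega> J)" .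
  qed
  also have "\<dots> = ?s * (\<integral>x. \<integral>y. tensor_fun I J f g' (merge I J (x, y)) * \<Phi> (merge I J (x, y))
      \<partial>block_measure \<Omega> J \<partial>block_measure \<Omega> I)" by simp
  also have "\<dots> = ?s * (\<integral>z. tensor_fun I J f g' z * \<Phi> z \<partial>block_measure \<Omega> (I \<union> J))"
    by (simp only: integral_block_union(1)[OF I J IJ int[OF g(2) t]])
  finally show ?thesis .
qed

text \<open>
  The previous lemma moves the derivatives of the two blocks to the factors one block at a time. The
  intermediate function \<open>classical_deriv I \<alpha> \<Phi>\<close> is again a test function on the union.
\<close>

lemma is_weak_deriv_tensor:
  assumes I: "good_block \<Omega> I" and J: "good_block \<Omega> J" and less: "\<forall>i\<in>I. \<forall>j\<in>J. i < j"
    and f: "square_integrable \<Omega> I f" "square_integrable \<Omega> I f'" "is_weak_deriv \<Omega> I \<alpha> f f'"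
    and g: "square_integrable \<Omega> J g" "square_integrable \<Omega> J g'" "is_weak_deriv \<Omega> J \<alpha> g g'"
  shows "is_weak_deriv \<Omega> (I \<union> J) \<alpha> (tensor_fun I J f g) (tensor_fun I J f' g')"
  unfolding is_weak_deriv_def
proof (intro allI impI)
  fix \<Phi> assume t: "test_function \<Omega> (I \<union> J) \<Phi>"
  let ?M = "block_measure \<Omega> (I \<union> J)"
  have IJ: "I \<inter> J = {}" "J \<inter> I = {}" using less by fastforce+
  have fin: "finite I" "finite J" using I J good_block_finite by auto
  have tI: "test_function \<Omega> (I \<union> J) (classical_deriv I \<alpha> \<Phi>)"
    by (rule test_function_classical_deriv[OF t fin(1)])
  have "(\<integral>z. tensor_fun I J f g z * classical_deriv (I \<union> J) \<alpha> \<Phi> z \<partial>?M) =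
      (\<integral>z. tensor_fun I J f g z * classical_deriv J \<alpha> (classical_deriv I \<alpha> \<Phi>) z \<partial>?M)"
    by (subst classical_deriv_union[OF fin less]) simp_all
  also have "\<dots> = (-1) ^ (\<Sum>j\<in>J. \<alpha> j) * (\<integral>z. tensor_fun I J f g' z * classical_deriv I \<alpha> \<Phi> z \<partial>?M)"
    by (rule weak_deriv_second_factor[OF I J IJ(1) f(1) g tI])
  also have "(\<integral>z. tensor_fun I J f g' z * classical_deriv I \<alpha> \<Phi> z \<partial>?M) =
      (-1) ^ (\<Sum>i\<in>I. \<alpha> i) * (\<integral>z. tensor_fun I J f' g' z * \<Phi> z \<partial>?M)"
    using weak_deriv_second_factor[OF J I IJ(2) g(2) f, of \<Phi>] t
    by (simp add: tensor_fun_commute[of J I] Un_commute)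
  also have "(-1) ^ (\<Sum>j\<in>J. \<alpha> j) * ((-1) ^ (\<Sum>i\<in>I. \<alpha> i) * (\<integral>z. tensor_fun I J f' g' z * \<Phi> z \<partial>?M)) =
      (-1) ^ (\<Sum>j\<in>I \<union> J. \<alpha> j) * (\<integral>z. tensor_fun I J f' g' z * \<Phi> z \<partial>?M)"
    using fin IJ by (simp add: sum.union_disjoint power_add)
  finally show "(\<integral>z. tensor_fun I J f g z * classical_deriv (I \<union> J) \<alpha> \<Phi> z \<partial>?M) =
      (-1) ^ (\<Sum>j\<in>I \<union> J. \<alpha> j) * (\<integral>z. tensor_fun I J f' g' z * \<Phi> z \<partial>?M)" .
qed

lemma Hk_semi_inner_space: "good_block \<Omega> J \<Longrightarrow> semi_inner_space (Hk k \<Omega> J) (Hk_inner k \<Omega> J)"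
  unfolding Hk_def Hk_inner_def by (rule sobolev_semi_inner_space)

definition join_indices :: "nat set \<Rightarrow> multi_index \<Rightarrow> multi_index \<Rightarrow> multi_index" where
  "join_indices I \<beta> \<gamma> = (\<lambda>i. if i \<in> I then \<beta> i else \<gamma> i)"

lemma bij_betw_join_indices:
  assumes "I \<inter> J = {}"
  shows "bij_betw (\<lambda>(\<beta>, \<gamma>). join_indices I \<beta> \<gamma>)
    (tensor_indices k I \<times> tensor_indices k J) (tensor_indices k (I \<union> J))"
  by (rule bij_betw_byWitness[where
        f' = "\<lambda>\<alpha>. (\<lambda>i. if i \<in> I then \<alpha> i else 0, \<lambda>i. if i \<in> J then \<alpha> i else 0)"])
     (use assms in \<open>auto simp: join_indices_def tensor_indices_def fun_eq_iff split: if_splits\<close>)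

lemma weak_deriv_tensor:
  assumes I: "good_block \<Omega> I" and J: "good_block \<Omega> J" and less: "\<forall>i\<in>I. \<forall>j\<in>J. i < j"
    and f: "f \<in> Hk k \<Omega> I" and g: "g \<in> Hk k \<Omega> J"
    and \<beta>: "\<beta> \<in> tensor_indices k I" and \<gamma>: "\<gamma> \<in> tensor_indices k J"
  shows "is_weak_deriv \<Omega> (I \<union> J) (join_indices I \<beta> \<gamma>) (tensor_fun I J f g)
      (tensor_fun I J (weak_deriv \<Omega> I \<beta> f) (weak_deriv \<Omega> J \<gamma> g))"
    and "square_integrable \<Omega> (I \<union> J) (tensor_fun I J (weak_deriv \<Omega> I \<beta> f) (weak_deriv \<Omega> J \<gamma> g))"
proof -
  note f' = sobolev_spaceD[OF f[unfolded Hk_def]] and g' = sobolev_spaceD[OF g[unfolded Hk_def]]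
  have IJ: "I \<inter> J = {}" using less by fastforce
  have "is_weak_deriv \<Omega> I (join_indices I \<beta> \<gamma>) f (weak_deriv \<Omega> I \<beta> f)"
    using f'(3)[OF \<beta>] by (subst is_weak_deriv_cong[of _ _ \<beta>]) (auto simp: good_block_finite[OF I] join_indices_def)
  moreover have "is_weak_deriv \<Omega> J (join_indices I \<beta> \<gamma>) g (weak_deriv \<Omega> J \<gamma> g)"
    using g'(3)[OF \<gamma>] IJ
    by (subst is_weak_deriv_cong[of _ _ \<gamma>]) (auto simp: good_block_finite[OF J] join_indices_def)
  ultimately show "is_weak_deriv \<Omega> (I \<union> J) (join_indices I \<beta> \<gamma>) (tensor_fun I J f g)
      (tensor_fun I J (weak_deriv \<Omega> I \<beta> f) (weak_deriv \<Omega> J \<gamma> g))"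
    by (intro is_weak_deriv_tensor I J less f'(1) f'(2)[OF \<beta>] g'(1) g'(2)[OF \<gamma>])
  show "square_integrable \<Omega> (I \<union> J) (tensor_fun I J (weak_deriv \<Omega> I \<beta> f) (weak_deriv \<Omega> J \<gamma> g))"
    by (intro square_integrable_tensor I J IJ f'(2)[OF \<beta>] g'(2)[OF \<gamma>])
qed

lemma Hk_tensor:
  assumes I: "good_block \<Omega> I" and J: "good_block \<Omega> J" and less: "\<forall>i\<in>I. \<forall>j\<in>J. i < j"
    and f: "f \<in> Hk k \<Omega> I" and g: "g \<in> Hk k \<Omega> J"
  shows "tensor_fun I J f g \<in> Hk k \<Omega> (I \<union> J)"
  unfolding Hk_def sobolev_space_def
proof (intro CollectI conjI ballI)
  have IJ: "I \<inter> J = {}" using less by fastforce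
  show "square_integrable \<Omega> (I \<union> J) (tensor_fun I J f g)"
    using f g by (intro square_integrable_tensor I J IJ) (auto simp: Hk_def sobolev_space_def)
  fix \<alpha> assume "\<alpha> \<in> tensor_indices k (I \<union> J)"
  then have "\<alpha> \<in> (\<lambda>(\<beta>, \<gamma>). join_indices I \<beta> \<gamma>) ` (tensor_indices k I \<times> tensor_indices k J)"
    by (simp only: bij_betw_imp_surj_on[OF bij_betw_join_indices[OF IJ]])
  then obtain \<beta> \<gamma> where "\<alpha> = join_indices I \<beta> \<gamma>" "\<beta> \<in> tensor_indices k I" "\<gamma> \<in> tensor_indices k J"
    by auto
  then show "\<exists>h. square_integrable \<Omega> (I \<union> J) h \<and> is_weak_deriv \<Omega> (I \<union> J) \<alpha> (tensor_fun I J f g) h"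
    using weak_deriv_tensor[OF I J less f g] by blast
qed

text \<open>
  The multi-indices bounded by \<open>k\<close> in every coordinate form a product, so both the sum over them and
  the integrals factorise. This is the isometry of the tensor product on elementary tensors.
\<close>

lemma Hk_inner_tensor:
  assumes I: "good_block \<Omega> I" and J: "good_block \<Omega> J" and less: "\<forall>i\<in>I. \<forall>j\<in>J. i < j"
    and f: "f \<in> Hk k \<Omega> I" and g: "g \<in> Hk k \<Omega> J" and f': "f' \<in> Hk k \<Omega> I" and g': "g' \<in> Hk k \<Omega> J"
  shows "Hk_inner k \<Omega> (I \<union> J) (tensor_fun I J f g) (tensor_fun I J f' g') =
    Hk_inner k \<Omega> I f f' * Hk_inner k \<Omega> J g g'"
proof -
  let ?M = "block_measure \<Omega> (I \<union> J)" and ?F = "tensor_fun I J f g" and ?G = "tensor_fun I J f' g'"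
  let ?A = "\<lambda>\<beta>. \<integral>x. weak_deriv \<Omega> I \<beta> f x * weak_deriv \<Omega> I \<beta> f' x \<partial>block_measure \<Omega> I"
  let ?C = "\<lambda>\<gamma>. \<integral>y. weak_deriv \<Omega> J \<gamma> g y * weak_deriv \<Omega> J \<gamma> g' y \<partial>block_measure \<Omega> J"
  have IJ: "I \<inter> J = {}" using less by fastforce
  have FG: "?F \<in> Hk k \<Omega> (I \<union> J)" "?G \<in> Hk k \<Omega> (I \<union> J)"
    using Hk_tensor[OF I J less] f g f' g' by auto
  have main: "(\<integral>z. weak_deriv \<Omega> (I \<union> J) (join_indices I \<beta> \<gamma>) ?F z * weak_deriv \<Omega> (I \<union> J) (join_indices I \<beta> \<gamma>) ?G z \<partial>?M) =
      ?A \<beta> * ?C \<gamma>" if \<beta>: "\<beta> \<in> tensor_indices k I" and \<gamma>: "\<gamma> \<in> tensor_indices k J" for \<beta> \<gamma>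
  proof -
    let ?\<alpha> = "join_indices I \<beta> \<gamma>"
    have \<alpha>: "?\<alpha> \<in> tensor_indices k (I \<union> J)"
      using bij_betw_apply[OF bij_betw_join_indices[OF IJ], of "(\<beta>, \<gamma>)"] \<beta> \<gamma> by simp
    note D = weak_deriv_tensor[OF I J less f g \<beta> \<gamma>] and D' = weak_deriv_tensor[OF I J less f' g' \<beta> \<gamma>]
    note L = sobolev_spaceD(2)[OF FG(1)[unfolded Hk_def] \<alpha>]
      and L' = sobolev_spaceD(2)[OF FG(2)[unfolded Hk_def] \<alpha>]
    have AE: "AE z in ?M. weak_deriv \<Omega> (I \<union> J) ?\<alpha> ?F z = tensor_fun I J (weak_deriv \<Omega> I \<beta> f) (weak_deriv \<Omega> J \<gamma> g) z"
      "AE z in ?M. weak_deriv \<Omega> (I \<union> J) ?\<alpha> ?G z = tensor_fun I J (weak_deriv \<Omega> I \<beta> f') (weak_deriv \<Omega> J \<gamma> g') z"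
      by (rule weak_deriv_eq[OF good_block_union[OF I J] D(2,1)])
         (rule weak_deriv_eq[OF good_block_union[OF I J] D'(2,1)])
    have "(\<integral>z. weak_deriv \<Omega> (I \<union> J) ?\<alpha> ?F z * weak_deriv \<Omega> (I \<union> J) ?\<alpha> ?G z \<partial>?M) =
      (\<integral>z. tensor_fun I J (weak_deriv \<Omega> I \<beta> f) (weak_deriv \<Omega> J \<gamma> g) z *
        tensor_fun I J (weak_deriv \<Omega> I \<beta> f') (weak_deriv \<Omega> J \<gamma> g') z \<partial>?M)"
    proof (rule integral_cong_AE)
      show "AE z in ?M. weak_deriv \<Omega> (I \<union> J) ?\<alpha> ?F z * weak_deriv \<Omega> (I \<union> J) ?\<alpha> ?G z =
        tensor_fun I J (weak_deriv \<Omega> I \<beta> f) (weak_deriv \<Omega> J \<gamma> g) z *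
        tensor_fun I J (weak_deriv \<Omega> I \<beta> f') (weak_deriv \<Omega> J \<gamma> g') z"
        using AE by eventually_elim simp
    qed (rule borel_measurable_integrable, rule square_integrable_mult, fact L, fact L',
         rule borel_measurable_integrable, rule square_integrable_mult, fact D(2), fact D'(2))
    also have "\<dots> = ?A \<beta> * ?C \<gamma>"
      using \<beta> \<gamma> f g f' g' unfolding Hk_def
      by (intro integral_tensor_mult I J IJ sobolev_spaceD(2))
    finally show ?thesis .
  qed
  have "Hk_inner k \<Omega> (I \<union> J) ?F ?G = (\<Sum>(\<beta>, \<gamma>)\<in>tensor_indices k I \<times> tensor_indices k J.
      \<integral>z. weak_deriv \<Omega> (I \<union> J) (join_indices I \<beta> \<gamma>) ?F z * weak_deriv \<Omega> (I \<union> J) (join_indices I \<beta> \<gamma>) ?G z \<partial>?M)"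
    unfolding Hk_inner_def sobolev_inner_def
    by (subst sum.reindex_bij_betw[OF bij_betw_join_indices[OF IJ], symmetric]) (simp add: case_prod_beta)
  also have "\<dots> = (\<Sum>(\<beta>, \<gamma>)\<in>tensor_indices k I \<times> tensor_indices k J. ?A \<beta> * ?C \<gamma>)"
    using main by (intro sum.cong) auto
  also have "\<dots> = (\<Sum>\<beta>\<in>tensor_indices k I. ?A \<beta>) * (\<Sum>\<gamma>\<in>tensor_indices k J. ?C \<gamma>)"
    by (simp add: sum_product sum.cartesian_product)
  finally show ?thesis by (simp add: Hk_inner_def sobolev_inner_def)
qed

section \<open>Truncating one bi-orthogonal decomposition\<close>

text \<open>
  One level of the error recursion: the factors \<open>\<phi> i\<close> of the \<open>r\<close> retained terms are replaced by
  approximations \<open>T i\<close>. The modes \<open>\<psi> i\<close> are orthonormal, so the error terms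
  \<open>\<psi> i \<otimes> (\<phi> i - T i)\<close> are orthogonal to one another and to all discarded terms.
\<close>

lemma biorthogonal_truncation_error:
  assumes good: "good_block \<Omega> {j..d}" and j: "1 \<le> j" "j < d"
    and dec: "biorthogonal_decomposition k \<Omega> d j v lam \<psi> \<phi>"
    and T: "\<And>i. 1 \<le> i \<Longrightarrow> i \<le> r \<Longrightarrow> T i \<in> Hk k \<Omega> {j+1..d}"
  defines "S \<equiv> (\<lambda>x. \<Sum>i=1..r. lam i * tensor_fun {j} {j+1..d} (\<psi> i) (T i) x)"
  shows "S \<in> Hk k \<Omega> {j..d}"
    and "(\<lambda>i. (lam i)\<^sup>2) summable_on {r<..}"
    and "(Hk_norm k \<Omega> {j..d} (\<lambda>x. v x - S x))\<^sup>2 =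
      (\<Sum>\<^sub>\<infinity>i\<in>{r<..}. (lam i)\<^sup>2) +
      (\<Sum>i=1..r. (lam i)\<^sup>2 * (Hk_norm k \<Omega> {j+1..d} (\<lambda>y. \<phi> i y - T i y))\<^sup>2)"
proof -
  let ?I = "{j}" and ?J = "{j+1..d}"
  have un: "?I \<union> ?J = {j..d}" using j by auto
  have gI: "good_block \<Omega> ?I" and gJ: "good_block \<Omega> ?J" using good j by (auto simp: good_block_def)
  have less: "\<forall>a\<in>?I. \<forall>b\<in>?J. a < b" by auto
  interpret J: semi_inner_space "Hk k \<Omega> ?J" "Hk_inner k \<Omega> ?J" by (rule Hk_semi_inner_space[OF gJ])
  interpret W: semi_inner_space "Hk k \<Omega> {j..d}" "Hk_inner k \<Omega> {j..d}" by (rule Hk_semi_inner_space[OF good])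
  have v: "v \<in> Hk k \<Omega> {j..d}"
    and \<psi>: "\<And>i. 1 \<le> i \<Longrightarrow> \<psi> i \<in> Hk k \<Omega> ?I"
      "\<And>i l. 1 \<le> i \<Longrightarrow> 1 \<le> l \<Longrightarrow> Hk_inner k \<Omega> ?I (\<psi> i) (\<psi> l) = (if i = l then 1 else 0)"
    and \<phi>: "\<And>i. 1 \<le> i \<Longrightarrow> \<phi> i \<in> Hk k \<Omega> ?J"
      "\<And>i l. 1 \<le> i \<Longrightarrow> 1 \<le> l \<Longrightarrow> Hk_inner k \<Omega> ?J (\<phi> i) (\<phi> l) = (if i = l then 1 else 0)"
    and lim: "(\<lambda>N. Hk_norm k \<Omega> {j..d}
        (\<lambda>x. v x - (\<Sum>i=1..N. lam i * tensor_fun ?I ?J (\<psi> i) (\<phi> i) x))) \<longlonglongrightarrow> 0"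
    using dec by (simp_all add: biorthogonal_decomposition_def orthonormal_modes_def)
  note tmem = Hk_tensor[OF gI gJ less, unfolded un]
    and tinner = Hk_inner_tensor[OF gI gJ less, unfolded un]
  define w where "w = (\<lambda>i. tensor_fun ?I ?J (\<psi> i) (\<phi> i))"
  define E where "E = (\<lambda>i y. \<phi> i y - T i y)"
  define D where "D = (\<lambda>i. tensor_fun ?I ?J (\<psi> i) (E i))"
  have E: "E i \<in> Hk k \<Omega> ?J" if "1 \<le> i" "i \<le> r" for i
    unfolding E_def using that by (intro J.diff_mem \<phi> T)
  have S: "(\<lambda>x. v x - S x) = (\<lambda>x. v x - (\<Sum>i=1..r. lam i * (w i x - D i x)))"
    by (simp add: S_def w_def D_def E_def tensor_fun_def algebra_simps)
  show "S \<in> Hk k \<Omega> {j..d}"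
    unfolding S_def by (intro W.sum_mem W.scale_mem tmem \<psi> T) auto
  note series = W.perturbed_orthonormal_series[of v w lam r D "\<lambda>i. Hk_inner k \<Omega> ?J (E i) (E i)"]
  have mode: "tensor_fun ?I ?J (\<psi> i) g \<in> Hk k \<Omega> {j..d}"
    if "1 \<le> i" "g \<in> Hk k \<Omega> ?J" for i g
    by (rule tmem[OF \<psi>(1)[OF that(1)] that(2)])
  have mode_inner: "Hk_inner k \<Omega> {j..d} (tensor_fun ?I ?J (\<psi> i) g) (tensor_fun ?I ?J (\<psi> l) h) =
      (if i = l then Hk_inner k \<Omega> ?J g h else 0)"
    if "1 \<le> i" "1 \<le> l" "g \<in> Hk k \<Omega> ?J" "h \<in> Hk k \<Omega> ?J" for i l g h
    using tinner[OF \<psi>(1)[OF that(1)] that(3) \<psi>(1)[OF that(2)] that(4)] \<psi>(2)[OF that(1,2)] by simp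
  have prems: "w i \<in> Hk k \<Omega> {j..d}" if "1 \<le> i" for i
    unfolding w_def by (rule mode[OF that \<phi>(1)[OF that]])
  have prems2: "Hk_inner k \<Omega> {j..d} (w i) (w l) = (if i = l then 1 else 0)" if "1 \<le> i" "1 \<le> l" for i l
    unfolding w_def using mode_inner[OF that \<phi>(1)[OF that(1)] \<phi>(1)[OF that(2)]] \<phi>(2)[OF that] by (cases "i = l") simp_all
  have prems3: "D i \<in> Hk k \<Omega> {j..d}" if "1 \<le> i" "i \<le> r" for i
    unfolding D_def by (rule mode[OF that(1) E[OF that]])
  have prems4: "Hk_inner k \<Omega> {j..d} (D i) (D l) = (if i = l then Hk_inner k \<Omega> ?J (E i) (E i) else 0)"
    if "1 \<le> i" "i \<le> r" "1 \<le> l" "l \<le> r" for i l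
    unfolding D_def using mode_inner[OF that(1,3) E[OF that(1,2)] E[OF that(3,4)]] by simp
  have prems5: "Hk_inner k \<Omega> {j..d} (D i) (w l) = 0" if "1 \<le> i" "i \<le> r" "r < l" for i l
  proof -
    have l: "1 \<le> l" "i \<noteq> l" using that by auto
    then show ?thesis
      unfolding D_def w_def using mode_inner[OF that(1) l(1) E[OF that(1,2)] \<phi>(1)[OF l(1)]] by simp
  qed
  have lim': "(\<lambda>n. sqrt (Hk_inner k \<Omega> {j..d} (\<lambda>x. v x - (\<Sum>i=1..n. lam i * w i x))
      (\<lambda>x. v x - (\<Sum>i=1..n. lam i * w i x)))) \<longlonglongrightarrow> 0"
    using lim by (simp add: Hk_norm_def w_def)
  show "(\<lambda>i. (lam i)\<^sup>2) summable_on {r<..}" by (rule series(1)[OF v prems prems2 lim' prems3 prems4 prems5])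
  have sq: "(Hk_norm k \<Omega> ?J (\<lambda>y. \<phi> i y - T i y))\<^sup>2 = Hk_inner k \<Omega> ?J (E i) (E i)" for i
    unfolding Hk_norm_def E_def by (rule real_sqrt_pow2[OF J.nonneg])
  have sqW: "(Hk_norm k \<Omega> {j..d} f)\<^sup>2 = Hk_inner k \<Omega> {j..d} f f" for f
    unfolding Hk_norm_def by (rule real_sqrt_pow2[OF W.nonneg])
  show "(Hk_norm k \<Omega> {j..d} (\<lambda>x. v x - S x))\<^sup>2 =
      (\<Sum>\<^sub>\<infinity>i\<in>{r<..}. (lam i)\<^sup>2) +
      (\<Sum>i=1..r. (lam i)\<^sup>2 * (Hk_norm k \<Omega> ?J (\<lambda>y. \<phi> i y - T i y))\<^sup>2)"
    unfolding S sq sqW by (rule series(2)[OF v prems prems2 lim' prems3 prems4 prems5])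
qed

section \<open>Truncated multi-indices\<close>

lemma truncated_indices_0: "truncated_indices r 0 = {[]}"
  by (auto simp: truncated_indices_def)

lemma Cons_in_truncated_indices:
  "i # is \<in> truncated_indices r (Suc m) \<longleftrightarrow>
    i \<in> {1..r []} \<and> is \<in> truncated_indices (\<lambda>js. r (i # js)) m"
  unfolding truncated_indices_def by (auto simp: All_less_Suc2)

lemma truncated_indices_Suc:
  "truncated_indices r (Suc m) =
    (\<lambda>(i, is). i # is) ` (SIGMA i:{1..r []}. truncated_indices (\<lambda>js. r (i # js)) m)"
proof (intro equalityI subsetI)
  fix xs assume xs: "xs \<in> truncated_indices r (Suc m)"
  then obtain i "is" where "xs = i # is" by (cases xs) (auto simp: truncated_indices_def)
  then show "xs \<in> (\<lambda>(i, is). i # is) ` (SIGMA i:{1..r []}. truncated_indices (\<lambda>js. r (i # js)) m)"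
    using xs by (auto simp: Cons_in_truncated_indices)
qed (auto simp: Cons_in_truncated_indices)

lemma finite_truncated_indices: "finite (truncated_indices r m)"
  by (induction m arbitrary: r) (auto simp: truncated_indices_0 truncated_indices_Suc)

lemma sum_truncated_indices_Suc:
  "(\<Sum>is\<in>truncated_indices r (Suc m). f is) =
    (\<Sum>i=1..r []. \<Sum>is\<in>truncated_indices (\<lambda>js. r (i # js)) m. f (i # is))"
proof -
  have "inj_on (\<lambda>(i, is). i # is) (SIGMA i:{1..r []}. truncated_indices (\<lambda>js. r (i # js)) m)"
    by (auto simp: inj_on_def)
  then have "(\<Sum>is\<in>truncated_indices r (Suc m). f is) =
      (\<Sum>(i, is)\<in>(SIGMA i:{1..r []}. truncated_indices (\<lambda>js. r (i # js)) m). f (i # is))"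
    unfolding truncated_indices_Suc by (subst sum.reindex) (auto simp: case_prod_beta)
  then show ?thesis by (simp add: sum.Sigma finite_truncated_indices)
qed

lemma prod_take_Cons:
  "(\<Prod>l=1..Suc m. f (take l (i # is))) = f [i] * (\<Prod>l=1..m. f (i # take l is))"
  for f :: "'a list \<Rightarrow> real"
proof -
  have "(\<Prod>l=1..Suc m. f (take l (i # is))) = (\<Prod>l=0..m. f (take (Suc l) (i # is)))"
    using prod.shift_bounds_cl_Suc_ivl[of "\<lambda>l. f (take l (i # is))" 0 m] by simp
  then show ?thesis by (simp add: prod.atLeast_Suc_atMost)
qed

text \<open>
  The right-hand side of the error formula for \<open>m\<close> levels, with \<open>a\<close> in the place of the squared
  coefficients. Its value for \<open>Suc m\<close> levels is expressed through the values for \<open>m\<close> levels with the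
  first index split off, which is the form of the error recursion.
\<close>

definition tail_sum :: "(nat list \<Rightarrow> nat) \<Rightarrow> (nat list \<Rightarrow> real) \<Rightarrow> nat \<Rightarrow> real" where
  "tail_sum r a m = (\<Sum>j=1..m. \<Sum>is\<in>truncated_indices r (j - 1).
     \<Sum>\<^sub>\<infinity>i\<in>{r is<..}. \<Prod>l=1..j. a (take l (is @ [i])))"

lemma tail_sum_Suc:
  "tail_sum r a (Suc m) = (\<Sum>\<^sub>\<infinity>i\<in>{r []<..}. a [i]) +
    (\<Sum>i=1..r []. a [i] * tail_sum (\<lambda>js. r (i # js)) (\<lambda>js. a (i # js)) m)"
proof -
  define G where "G = (\<lambda>j. \<Sum>is\<in>truncated_indices r (j - 1).
     \<Sum>\<^sub>\<infinity>i\<in>{r is<..}. \<Prod>l=1..j. a (take l (is @ [i])))"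
  have "tail_sum r a (Suc m) = G 1 + (\<Sum>j=1..m. G (Suc j))"
    unfolding tail_sum_def G_def[symmetric]
    by (subst sum.atLeast_Suc_atMost) (simp_all add: sum.shift_bounds_cl_Suc_ivl del: sum.cl_ivl_Suc)
  also have "G 1 = (\<Sum>\<^sub>\<infinity>i\<in>{r []<..}. a [i])"
    by (simp add: G_def truncated_indices_0)
  also have "(\<Sum>j=1..m. G (Suc j)) = (\<Sum>j=1..m. \<Sum>i=1..r []. a [i] *
      (\<Sum>is\<in>truncated_indices (\<lambda>js. r (i # js)) (j - 1).
        \<Sum>\<^sub>\<infinity>i'\<in>{r (i # is)<..}. \<Prod>l=1..j. a (i # take l (is @ [i']))))"
  proof (intro sum.cong refl)
    fix j assume "j \<in> {1..m}"
    then obtain j' where j: "j = Suc j'" by (cases j) auto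
    show "G (Suc j) = (\<Sum>i=1..r []. a [i] * (\<Sum>is\<in>truncated_indices (\<lambda>js. r (i # js)) (j - 1).
        \<Sum>\<^sub>\<infinity>i'\<in>{r (i # is)<..}. \<Prod>l=1..j. a (i # take l (is @ [i']))))"
      unfolding G_def j diff_Suc_1 sum_truncated_indices_Suc append_Cons prod_take_Cons
        infsum_cmult_right' sum_distrib_left ..
  qed
  also have "\<dots> = (\<Sum>i=1..r []. a [i] * tail_sum (\<lambda>js. r (i # js)) (\<lambda>js. a (i # js)) m)"
    unfolding tail_sum_def sum_distrib_left by (rule sum.swap)
  finally show ?thesis .
qed

section \<open>Recursion over the levels of the Tensor Train\<close>

text \<open>
  The truncated expansion of \<open>\<phi> is\<close> when \<open>m\<close> levels are left, so that the leading variable is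
  \<open>d - m\<close>. The error formula is proved for it by induction on \<open>m\<close>, for all \<open>is\<close> at once.
\<close>

primrec TT_tail ::
  "nat \<Rightarrow> (nat list \<Rightarrow> nat) \<Rightarrow> (nat list \<Rightarrow> real) \<Rightarrow> (nat list \<Rightarrow> point \<Rightarrow> real) \<Rightarrow>
   (nat list \<Rightarrow> point \<Rightarrow> real) \<Rightarrow> nat \<Rightarrow> nat list \<Rightarrow> point \<Rightarrow> real" where
  "TT_tail d r lam \<psi> \<phi> 0 is = \<phi> is"
| "TT_tail d r lam \<psi> \<phi> (Suc m) is = (\<lambda>x. \<Sum>i=1..r is. lam (is @ [i]) *
     tensor_fun {d - Suc m} {d - m..d} (\<psi> (is @ [i])) (TT_tail d r lam \<psi> \<phi> m (is @ [i])) x)"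

text \<open>
  The argument is restricted to the block because for \<open>m = 0\<close> the right-hand side restricts it to
  \<open>{d}\<close> and the left-hand side does not.
\<close>

lemma TT_tail_eq_sum:
  "m < d \<Longrightarrow> TT_tail d r lam \<psi> \<phi> m is (restrict x {d - m..d}) =
    (\<Sum>js\<in>truncated_indices (\<lambda>js. r (is @ js)) m. (\<Prod>l=1..m. lam (is @ take l js)) *
      (\<Prod>l=1..m. \<psi> (is @ take l js) (restrict x {d - Suc m + l})) * \<phi> (is @ js) (restrict x {d}))"
proof (induction m arbitrary: "is")
  case 0
  then show ?case by (simp add: truncated_indices_0)
next
  case (Suc m)
  have r: "restrict (restrict x {d - Suc m..d}) {d - m..d} = restrict x {d - m..d}"
    "restrict (restrict x {d - Suc m..d}) {d - Suc m} = restrict x {d - Suc m}"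
    using Suc.prems by (auto simp: restrict_def fun_eq_iff)
  have prod\<psi>: "(\<Prod>l=1..Suc m. \<psi> (is @ take l (i # js)) (restrict x {d - Suc (Suc m) + l})) =
      \<psi> (is @ [i]) (restrict x {d - Suc m}) *
      (\<Prod>l=1..m. \<psi> ((is @ [i]) @ take l js) (restrict x {d - Suc m + l}))" for i js
  proof -
    let ?f = "\<lambda>l. \<psi> (is @ take l (i # js)) (restrict x {d - Suc (Suc m) + l})"
    have "(\<Prod>l=1..Suc m. ?f l) = (\<Prod>l=0..m. ?f (Suc l))"
      using prod.shift_bounds_cl_Suc_ivl[of ?f 0 m] by simp
    also have "\<dots> = ?f 1 * (\<Prod>l=1..m. ?f (Suc l))" by (simp add: prod.atLeast_Suc_atMost)
    finally show ?thesis using Suc.prems by (simp add: Suc_diff_Suc)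
  qed
  have prodlam: "(\<Prod>l=1..Suc m. lam (is @ take l (i # js))) =
      lam (is @ [i]) * (\<Prod>l=1..m. lam ((is @ [i]) @ take l js))" for i js
    using prod_take_Cons[of "\<lambda>ks. lam (is @ ks)"] by simp
  have "TT_tail d r lam \<psi> \<phi> (Suc m) is (restrict x {d - Suc m..d}) = (\<Sum>i=1..r is. lam (is @ [i]) *
      (\<psi> (is @ [i]) (restrict x {d - Suc m}) * TT_tail d r lam \<psi> \<phi> m (is @ [i]) (restrict x {d - m..d})))"
    by (simp add: tensor_fun_def r)
  also have "\<dots> = (\<Sum>js\<in>truncated_indices (\<lambda>js. r (is @ js)) (Suc m). (\<Prod>l=1..Suc m. lam (is @ take l js)) *
      (\<Prod>l=1..Suc m. \<psi> (is @ take l js) (restrict x {d - Suc (Suc m) + l})) * \<phi> (is @ js) (restrict x {d}))"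
    unfolding sum_truncated_indices_Suc prod\<psi> prodlam Suc.IH[OF Suc_lessD[OF Suc.prems]]
    by (simp only: sum_distrib_left mult_ac append_assoc append_Cons append_Nil append_Nil2)
  finally show ?case .
qed

text \<open>
  For \<open>m = 0\<close> nothing is truncated. In the step the approximations \<open>T i\<close> of the modes \<open>\<phi> (is @ [i])\<close> are
  the truncated expansions with \<open>m\<close> levels left, whose errors the induction hypothesis gives.
\<close>

lemma TT_tail_error:
  assumes dom: "\<And>j. j \<in> {1..d} \<Longrightarrow> one_dim_domain (\<Omega> j)"
    and TT: "TT_decomposition k \<Omega> d u lam \<psi> \<phi>"
  shows "m < d \<Longrightarrow> length is + m = d - 1 \<Longrightarrow> \<forall>i\<in>set is. 1 \<le> i \<Longrightarrow> \<phi> is \<in> Hk k \<Omega> {d - m..d} \<Longrightarrow>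
    TT_tail d r lam \<psi> \<phi> m is \<in> Hk k \<Omega> {d - m..d} \<and>
    (Hk_norm k \<Omega> {d - m..d} (\<lambda>x. \<phi> is x - TT_tail d r lam \<psi> \<phi> m is x))\<^sup>2 =
      tail_sum (\<lambda>js. r (is @ js)) (\<lambda>js. (lam (is @ js))\<^sup>2) m"
proof (induction m arbitrary: "is")
  case 0
  have "good_block \<Omega> {d - 0..d}" using dom 0 by (simp add: good_block_def)
  then interpret semi_inner_space "Hk k \<Omega> {d - 0..d}" "Hk_inner k \<Omega> {d - 0..d}"
    by (rule Hk_semi_inner_space)
  show ?case
    using 0 zero_left[OF zero_mem] by (simp add: Hk_norm_def tail_sum_def)
next
  case (Suc m)
  define j where "j = d - Suc m"
  have j: "1 \<le> j" "j < d" "j \<in> {1..d - 1}" "j + 1 = d - m" "length is = j - 1"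
    using Suc.prems by (auto simp: j_def)
  have good: "good_block \<Omega> {j..d}" using dom j by (auto simp: good_block_def)
  have dec: "biorthogonal_decomposition k \<Omega> d j (\<phi> is)
      (\<lambda>i. lam (is @ [i])) (\<lambda>i. \<psi> (is @ [i])) (\<lambda>i. \<phi> (is @ [i]))"
    using TT j(3,5) Suc.prems(3) unfolding TT_decomposition_def by blast
  have \<phi>: "\<phi> (is @ [i]) \<in> Hk k \<Omega> {d - m..d}" if "1 \<le> i" for i
    using dec that j(4) by (simp add: biorthogonal_decomposition_def orthonormal_modes_def)
  have IH: "TT_tail d r lam \<psi> \<phi> m (is @ [i]) \<in> Hk k \<Omega> {d - m..d} \<and>
    (Hk_norm k \<Omega> {d - m..d} (\<lambda>x. \<phi> (is @ [i]) x - TT_tail d r lam \<psi> \<phi> m (is @ [i]) x))\<^sup>2 =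
      tail_sum (\<lambda>js. r (is @ i # js)) (\<lambda>js. (lam (is @ i # js))\<^sup>2) m" if "1 \<le> i" for i
    using Suc.IH[of "is @ [i]"] Suc.prems \<phi>[OF that] that by simp
  have T: "TT_tail d r lam \<psi> \<phi> m (is @ [i]) \<in> Hk k \<Omega> {j+1..d}" if "1 \<le> i" "i \<le> r is" for i
    using IH[OF that(1)] j(4) by simp
  note err = biorthogonal_truncation_error[where r = "r is" and
      T = "\<lambda>i. TT_tail d r lam \<psi> \<phi> m (is @ [i])", OF good j(1,2) dec T]
  have tail: "TT_tail d r lam \<psi> \<phi> (Suc m) is = (\<lambda>x. \<Sum>i=1..r is. lam (is @ [i]) *
      tensor_fun {j} {j+1..d} (\<psi> (is @ [i])) (TT_tail d r lam \<psi> \<phi> m (is @ [i])) x)"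
    unfolding j(4) by (simp only: TT_tail.simps j_def)
  have "(Hk_norm k \<Omega> {j..d} (\<lambda>x. \<phi> is x - TT_tail d r lam \<psi> \<phi> (Suc m) is x))\<^sup>2 =
      (\<Sum>\<^sub>\<infinity>i\<in>{r is<..}. (lam (is @ [i]))\<^sup>2) + (\<Sum>i=1..r is. (lam (is @ [i]))\<^sup>2 *
        tail_sum (\<lambda>js. r (is @ i # js)) (\<lambda>js. (lam (is @ i # js))\<^sup>2) m)"
  proof -
    have "(Hk_norm k \<Omega> {j..d} (\<lambda>x. \<phi> is x - TT_tail d r lam \<psi> \<phi> (Suc m) is x))\<^sup>2 =
      (\<Sum>\<^sub>\<infinity>i\<in>{r is<..}. (lam (is @ [i]))\<^sup>2) + (\<Sum>i=1..r is. (lam (is @ [i]))\<^sup>2 *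
        (Hk_norm k \<Omega> {j+1..d} (\<lambda>y. \<phi> (is @ [i]) y - TT_tail d r lam \<psi> \<phi> m (is @ [i]) y))\<^sup>2)"
      unfolding tail by (rule err(3))
    then show ?thesis using IH unfolding j(4) by simp
  qed
  moreover have "TT_tail d r lam \<psi> \<phi> (Suc m) is \<in> Hk k \<Omega> {j..d}"
    unfolding tail by (rule err(1))
  ultimately show ?case
    unfolding tail_sum_Suc by (simp add: j_def del: TT_tail.simps)
qed

lemma TT_truncation_eq_tail:
  assumes "2 \<le> d"
  shows "TT_truncation d r lam \<psi> \<phi> = TT_tail d r lam \<psi> \<phi> (d - 1) []"
proof
  fix x :: point
  obtain m where m: "d - 1 = Suc m" using assms by (cases "d - 1") auto
  have "restrict (restrict x {d - Suc m..d}) {d - m..d} = restrict x {d - m..d}"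
    "restrict (restrict x {d - Suc m..d}) {d - Suc m} = restrict x {d - Suc m}"
    by (auto simp: restrict_def fun_eq_iff)
  then have "TT_tail d r lam \<psi> \<phi> (d - 1) [] x = TT_tail d r lam \<psi> \<phi> (d - 1) [] (restrict x {d - (d - 1)..d})"
    unfolding m by (simp add: tensor_fun_def)
  also have "\<dots> = TT_truncation d r lam \<psi> \<phi> x"
    using assms by (subst TT_tail_eq_sum) (simp_all add: TT_truncation_def)
  finally show "TT_truncation d r lam \<psi> \<phi> x = TT_tail d r lam \<psi> \<phi> (d - 1) [] x" ..
qed

text \<open>
  Only the last coefficient depends on \<open>i\<close>, and its squares are summable because it is the coefficient
  in a convergent orthonormal expansion of \<open>\<phi> is\<close>.
\<close>

lemma TT_coefficients_summable:
  assumes dom: "\<And>j. j \<in> {1..d} \<Longrightarrow> one_dim_domain (\<Omega> j)"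
    and TT: "TT_decomposition k \<Omega> d u lam \<psi> \<phi>"
    and j: "j \<in> {1..d-1}" and trunc: "is \<in> truncated_indices r (j - 1)"
  shows "(\<lambda>i. \<Prod>l=1..j. (lam (take l (is @ [i])))\<^sup>2) summable_on {r is<..}"
proof -
  obtain j' where j': "j = Suc j'" using j by (cases j) auto
  have len: "length is = j'" and pos: "\<forall>i\<in>set is. 1 \<le> i"
    using trunc by (auto simp: truncated_indices_def j' in_set_conv_nth)
  have dec: "biorthogonal_decomposition k \<Omega> d j (\<phi> is)
      (\<lambda>i. lam (is @ [i])) (\<lambda>i. \<psi> (is @ [i])) (\<lambda>i. \<phi> (is @ [i]))"
    using TT j len pos j' unfolding TT_decomposition_def by simp
  have good: "good_block \<Omega> {j..d}" using dom j by (auto simp: good_block_def)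
  have bounds: "1 \<le> j" "j < d" using j by auto
  have \<phi>: "\<phi> (is @ [i]) \<in> Hk k \<Omega> {j+1..d}" if "1 \<le> i" "i \<le> r is" for i
    using dec that by (simp add: biorthogonal_decomposition_def orthonormal_modes_def)
  have "(\<lambda>i. (lam (is @ [i]))\<^sup>2) summable_on {r is<..}"
    by (rule biorthogonal_truncation_error(2)[OF good bounds dec \<phi>])
  then have "(\<lambda>i. (\<Prod>l=1..j'. (lam (take l is))\<^sup>2) * (lam (is @ [i]))\<^sup>2) summable_on {r is<..}"
    by (rule summable_on_cmult_right)
  moreover have "(\<Prod>l=1..j. (lam (take l (is @ [i])))\<^sup>2) =
      (\<Prod>l=1..j'. (lam (take l is))\<^sup>2) * (lam (is @ [i]))\<^sup>2" for i
    using len by (simp add: j')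
  ultimately show ?thesis by simp
qed

theorem proposition2p1:
  fixes d k :: nat and \<Omega> :: "nat \<Rightarrow> real set" and u :: "point \<Rightarrow> real"
    and lam :: "nat list \<Rightarrow> real" and \<psi> \<phi> :: "nat list \<Rightarrow> point \<Rightarrow> real"
    and r :: "nat list \<Rightarrow> nat"
  assumes "2 \<le> d"
    and "\<And>j. j \<in> {1..d} \<Longrightarrow> one_dim_domain (\<Omega> j)"
    and "u \<in> Hk k \<Omega> {1..d}"
    and "TT_decomposition k \<Omega> d u lam \<psi> \<phi>"
  shows "(\<forall>j\<in>{1..d-1}. \<forall>is\<in>truncated_indices r (j - 1).
            (\<lambda>i. \<Prod>l=1..j. (lam (take l (is @ [i])))\<^sup>2) summable_on {r is<..}) \<and>
         (Hk_norm k \<Omega> {1..d} (\<lambda>x. u x - TT_truncation d r lam \<psi> \<phi> x))\<^sup>2 =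
         (\<Sum>j=1..d-1. \<Sum>is\<in>truncated_indices r (j - 1).
            \<Sum>\<^sub>\<infinity>i\<in>{r is<..}. \<Prod>l=1..j. (lam (take l (is @ [i])))\<^sup>2)"
proof (intro conjI ballI)
  show "(\<lambda>i. \<Prod>l=1..j. (lam (take l (is @ [i])))\<^sup>2) summable_on {r is<..}"
    if "j \<in> {1..d-1}" "is \<in> truncated_indices r (j - 1)" for j "is"
    by (rule TT_coefficients_summable[OF assms(2,4) that])
  have "\<phi> [] = u" using assms(4) by (simp add: TT_decomposition_def)
  then show "(Hk_norm k \<Omega> {1..d} (\<lambda>x. u x - TT_truncation d r lam \<psi> \<phi> x))\<^sup>2 =
         (\<Sum>j=1..d-1. \<Sum>is\<in>truncated_indices r (j - 1).
            \<Sum>\<^sub>\<infinity>i\<in>{r is<..}. \<Prod>l=1..j. (lam (take l (is @ [i])))\<^sup>2)"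
    using TT_tail_error[OF assms(2,4), of "d - 1" "[]" r] assms(1,3)
    unfolding TT_truncation_eq_tail[OF assms(1)] tail_sum_def by simp
qed

end
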